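(* Let $(S,\mathcal{A},\mu)$ be a complete, $\sigma$-finite measure space, $E$ a Köthe function space over $(S,\mathcal{A},\mu)$, and $X$ a real Banach space such that the simple functions are dense in $E(X)$. If $X$ is locally octahedral (resp. weakly octahedral), then $E(X)$ is locally octahedral (resp. weakly octahedral). In particular, if $p\in[1,\infty)$ and $X$ is locally octahedral (resp. weakly octahedral), then so is $L^p(\mu,X)$. Moreover, $L^\infty(\mu,X)$ is locally octahedral whenever $X$ is locally octahedral.
   Context: A real Banach space $X$ is locally octahedral (LOH) if for every $x\in X$ and $\varepsilon>0$ there is $y\in S_X$ with $\|sx+y\|\ge(1-\varepsilon)(|s|\|x\|+1)$ for all $s\in\mathbb{R}$. $X$ is weakly octahedral (WOH) if for every finite-dimensional subspace $F$ of $X$, every $x^*\in B_{X^*}$ and every $\varepsilon>0$ there is $y\in S_X$ with $\|x+y\|\ge(1-\varepsilon)(|x^*(x)|+1)$ for all $x\in F$. ($S_X$ unit sphere, $B_{X^*}$ dual unit ball.) Köthe function space over $(S,\mathcal{A},\mu)$: a Banach space $(E,\|\cdot\|_E)$ of real-valued measurable functions on $S$ (modulo a.e. equality) such that $\chi_A\in E$ whenever $\mu(A)<\infty$; every $f\in E$ is integrable over every set of finite measure; and if $g$ is measurable, $f\in E$ and $|g|\le|f|$ a.e., then $g\in E$ and $\|g\|_E\le\|f\|_E$. A function $f:S\to X$ is simple if it is constant on each of finitely many disjoint measurable sets of finite measure and zero outside their union; Bochner-measurable if it is an a.e. limit of simple functions. $E(X)$ is the space of Bochner-measurable $f:S\to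 X$ (modulo a.e.) with $\|f(\cdot)\|\in E$, normed by $\|f\|=\|\,\|f(\cdot)\|\,\|_E$. $L^p(\mu,X)$ denotes the Lebesgue–Bochner spaces.
   Formalization: The measure is additionally assumed to be nonzero, μ(S) > 0; if μ = 0, then E(X) = {0} has an empty unit sphere and is neither locally nor weakly octahedral, so the claim fails there. *)

theory Defs
  imports "HOL-Analysis.Analysis" "HOL-Probability.Essential_Supremum"
begin

definition LOH :: "('x::real_normed_vector) itself \<Rightarrow> bool" where
  "LOH _ \<longleftrightarrow> (\<forall>x::'x. \<forall>\<epsilon>>0. \<exists>y::'x. norm y = 1 \<and>
      (\<forall>s::real. norm (s *\<^sub>R x + y) \<ge> (1 - \<epsilon>) * (\<bar>s\<bar> * norm x + 1)))"

text \<open>Weakly octahedral: finite-dimensional subspaces are spans of finite sets;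
  elements of the dual unit ball are linear functionals bounded by the norm.\<close>
definition WOH :: "('x::real_normed_vector) itself \<Rightarrow> bool" where
  "WOH _ \<longleftrightarrow> (\<forall>(A::'x set) (\<phi>::'x \<Rightarrow> real) \<epsilon>.
      finite A \<and> linear \<phi> \<and> (\<forall>x. \<bar>\<phi> x\<bar> \<le> norm x) \<and> \<epsilon> > 0 \<longrightarrow>
      (\<exists>y::'x. norm y = 1 \<and>
        (\<forall>x\<in>span A. norm (x + y) \<ge> (1 - \<epsilon>) * (\<bar>\<phi> x\<bar> + 1))))"

section \<open>The same notions for a space of functions S \<Rightarrow> X with pointwise operations,
  given by a carrier set V (representatives) and a seminorm N (the norm on the
  quotient modulo a.e. equality)\<close>

definition fspan :: "('s \<Rightarrow> 'x::real_vector) set \<Rightarrow> ('s \<Rightarrow> 'x) set" where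
  "fspan A = {h. \<exists>c::('s \<Rightarrow> 'x) \<Rightarrow> real. \<forall>t. h t = (\<Sum>a\<in>A. c a *\<^sub>R a t)}"

definition linear_on_fun :: "('s \<Rightarrow> 'x::real_vector) set \<Rightarrow> (('s \<Rightarrow> 'x) \<Rightarrow> real) \<Rightarrow> bool" where
  "linear_on_fun V \<phi> \<longleftrightarrow>
     (\<forall>f\<in>V. \<forall>g\<in>V. \<phi> (\<lambda>t. f t + g t) = \<phi> f + \<phi> g) \<and>
     (\<forall>f\<in>V. \<forall>c::real. \<phi> (\<lambda>t. c *\<^sub>R f t) = c * \<phi> f)"

definition LOH_fun :: "('s \<Rightarrow> 'x::real_vector) set \<Rightarrow> (('s \<Rightarrow> 'x) \<Rightarrow> real) \<Rightarrow> bool" where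
  "LOH_fun V N \<longleftrightarrow> (\<forall>f\<in>V. \<forall>\<epsilon>>0. \<exists>g\<in>V. N g = 1 \<and>
      (\<forall>s::real. N (\<lambda>t. s *\<^sub>R f t + g t) \<ge> (1 - \<epsilon>) * (\<bar>s\<bar> * N f + 1)))"

definition WOH_fun :: "('s \<Rightarrow> 'x::real_vector) set \<Rightarrow> (('s \<Rightarrow> 'x) \<Rightarrow> real) \<Rightarrow> bool" where
  "WOH_fun V N \<longleftrightarrow> (\<forall>A \<phi> \<epsilon>.
      finite A \<and> A \<subseteq> V \<and> linear_on_fun V \<phi> \<and> (\<forall>f\<in>V. \<bar>\<phi> f\<bar> \<le> N f) \<and> \<epsilon> > 0 \<longrightarrow>
      (\<exists>g\<in>V. N g = 1 \<and>
        (\<forall>h\<in>fspan A. N (\<lambda>t. h t + g t) \<ge> (1 - \<epsilon>) * (\<bar>\<phi> h\<bar> + 1))))"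

text \<open>E is the set of representatives (closed under a.e. equality by the lattice
  property), NE its norm; NE is a norm on the quotient modulo a.e. equality, and the
  quotient is complete.\<close>
definition koethe_space :: "'s measure \<Rightarrow> ('s \<Rightarrow> real) set \<Rightarrow> (('s \<Rightarrow> real) \<Rightarrow> real) \<Rightarrow> bool" where
  "koethe_space M E NE \<longleftrightarrow>
     E \<subseteq> borel_measurable M \<and>
     (\<forall>f\<in>E. \<forall>g\<in>E. (\<lambda>x. f x + g x) \<in> E \<and> NE (\<lambda>x. f x + g x) \<le> NE f + NE g) \<and>
     (\<forall>f\<in>E. \<forall>c::real. (\<lambda>x. c * f x) \<in> E \<and> NE (\<lambda>x. c * f x) = \<bar>c\<bar> * NE f) \<and>
     (\<forall>f\<in>E. NE f = 0 \<longrightarrow> (AE x in M. f x = 0)) \<and>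
     (\<forall>u::nat \<Rightarrow> 's \<Rightarrow> real. (\<forall>n. u n \<in> E) \<and>
        (\<forall>e>0. \<exists>K. \<forall>m\<ge>K. \<forall>n\<ge>K. NE (\<lambda>x. u m x - u n x) < e) \<longrightarrow>
        (\<exists>f\<in>E. (\<lambda>n. NE (\<lambda>x. u n x - f x)) \<longlonglongrightarrow> 0)) \<and>
     (\<forall>A\<in>sets M. emeasure M A < \<infinity> \<longrightarrow> indicator A \<in> E) \<and>
     (\<forall>f\<in>E. \<forall>A\<in>sets M. emeasure M A < \<infinity> \<longrightarrow> set_integrable M A f) \<and>
     (\<forall>f\<in>E. \<forall>g\<in>borel_measurable M. (AE x in M. \<bar>g x\<bar> \<le> \<bar>f x\<bar>) \<longrightarrow>
        g \<in> E \<and> NE g \<le> NE f)"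

text \<open>Simple functions: finitely many values on measurable sets, support of finite
  measure (library notion simple_bochner_integrable). Bochner-measurable: a.e. limit of
  simple functions.\<close>
definition bochner_measurable :: "'s measure \<Rightarrow> ('s \<Rightarrow> 'x::real_normed_vector) \<Rightarrow> bool" where
  "bochner_measurable M f \<longleftrightarrow> (\<exists>s::nat \<Rightarrow> 's \<Rightarrow> 'x. (\<forall>n. Bochner_Integration.simple_bochner_integrable M (s n)) \<and>
      (AE x in M. (\<lambda>n. s n x) \<longlonglongrightarrow> f x))"

definition kothe_bochner :: "'s measure \<Rightarrow> ('s \<Rightarrow> real) set \<Rightarrow> ('s \<Rightarrow> 'x::real_normed_vector) set" where
  "kothe_bochner M E = {f. bochner_measurable M f \<and> (\<lambda>x. norm (f x)) \<in> E}"

definition kothe_bochner_norm :: "(('s \<Rightarrow> real) \<Rightarrow> real) \<Rightarrow> ('s \<Rightarrow> 'x::real_normed_vector) \<Rightarrow> real" where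
  "kothe_bochner_norm NE f = NE (\<lambda>x. norm (f x))"

definition simple_dense :: "'s measure \<Rightarrow> ('s \<Rightarrow> real) set \<Rightarrow> (('s \<Rightarrow> real) \<Rightarrow> real) \<Rightarrow>
    ('x::real_normed_vector) itself \<Rightarrow> bool" where
  "simple_dense M E NE _ \<longleftrightarrow> (\<forall>f::'s \<Rightarrow> 'x. f \<in> kothe_bochner M E \<longrightarrow> (\<forall>e>0.
      \<exists>s. Bochner_Integration.simple_bochner_integrable M s \<and> kothe_bochner_norm NE (\<lambda>t. f t - s t) < e))"

definition Lp_bochner :: "'s measure \<Rightarrow> real \<Rightarrow> ('s \<Rightarrow> 'x::real_normed_vector) set" where
  "Lp_bochner M p = {f. bochner_measurable M f \<and> integrable M (\<lambda>x. norm (f x) powr p)}"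

definition Lp_bochner_norm :: "'s measure \<Rightarrow> real \<Rightarrow> ('s \<Rightarrow> 'x::real_normed_vector) \<Rightarrow> real" where
  "Lp_bochner_norm M p f = (\<integral>x. norm (f x) powr p \<partial>M) powr (1 / p)"

definition Linf_bochner :: "'s measure \<Rightarrow> ('s \<Rightarrow> 'x::real_normed_vector) set" where
  "Linf_bochner M = {f. bochner_measurable M f \<and> esssup M (\<lambda>x. ereal (norm (f x))) < \<infinity>}"

definition Linf_bochner_norm :: "'s measure \<Rightarrow> ('s \<Rightarrow> 'x::real_normed_vector) \<Rightarrow> real" where
  "Linf_bochner_norm M f = real_of_ereal (esssup M (\<lambda>x. ereal (norm (f x))))"

end

theory Submission
  imports Defs
begin

text \<open>Let \<open>f\<close> be a simple function in \<open>E(X)\<close> with values \<open>x\<^sub>i\<close> on disjoint cells \<open>A\<^sub>i\<close>. If \<open>y\<^sub>i\<close> is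
  almost \<open>\<ell>\<^sub>1\<close>-orthogonal to \<open>x\<^sub>i\<close>, then the function \<open>g\<close> equal to \<open>(\<parallel>x\<^sub>i\<parallel> / \<parallel>f\<parallel>) y\<^sub>i\<close> on \<open>A\<^sub>i\<close> is
  almost \<open>\<ell>\<^sub>1\<close>-orthogonal to \<open>f\<close>, and density gives local octahedrality of \<open>E(X)\<close>.

  For weak octahedrality, a functional \<open>\<phi>\<close> on \<open>E(X)\<close> restricts to a functional on \<open>X\<close> for each
  cell, of norm \<open>a\<^sub>i\<close> say, and \<open>a\<close> lies in the dual unit ball of the span of the indicators of the
  cells. Enlarging one weight moves \<open>a\<close> close to the dual unit sphere; if \<open>b\<close> is then a positive
  unit vector nearly norming \<open>a\<close>, and \<open>y\<^sub>i\<close> are chosen for the normalised restrictions of \<open>\<phi>\<close>, the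
  function equal to \<open>b\<^sub>i y\<^sub>i\<close> on \<open>A\<^sub>i\<close> works. A finite-dimensional space of arbitrary functions is
  first approximated by simple ones; only its elements of bounded norm matter.

  In \<open>L\<^sup>\<infinity>(\<mu>, X)\<close> it suffices to find a single nonnull set on which \<open>f\<close> is nearly constant and nearly
  of maximal norm, and to put \<open>g = y \<chi>\<^sub>B\<close>.\<close>

section \<open>Finite-dimensional subspaces of seminormed function spaces\<close>

lemma linear_on_fun_add:
  "linear_on_fun V \<phi> \<Longrightarrow> f \<in> V \<Longrightarrow> g \<in> V \<Longrightarrow> \<phi> (\<lambda>t. f t + g t) = \<phi> f + \<phi> g"
  by (simp add: linear_on_fun_def)

lemma linear_on_fun_scale:
  "linear_on_fun V \<phi> \<Longrightarrow> f \<in> V \<Longrightarrow> \<phi> (\<lambda>t. c *\<^sub>R f t) = c * \<phi> f"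
  by (simp add: linear_on_fun_def)

text \<open>Representatives with pointwise operations stand in for the quotient modulo a.e.
  equality, so \<open>N\<close> is only a seminorm. Nonnegativity follows from the axioms, as
  \<open>0 = N (f - f)\<close> is at most \<open>2 * N f\<close>.\<close>

locale function_seminorm =
  fixes V :: "('s \<Rightarrow> 'x::real_vector) set" and N :: "('s \<Rightarrow> 'x) \<Rightarrow> real"
  assumes zero_mem: "(\<lambda>t. 0) \<in> V"
    and add_mem: "f \<in> V \<Longrightarrow> g \<in> V \<Longrightarrow> (\<lambda>t. f t + g t) \<in> V"
    and scale_mem: "f \<in> V \<Longrightarrow> (\<lambda>t. c *\<^sub>R f t) \<in> V"
    and N_add: "f \<in> V \<Longrightarrow> g \<in> V \<Longrightarrow> N (\<lambda>t. f t + g t) \<le> N f + N g"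
    and N_scale: "f \<in> V \<Longrightarrow> N (\<lambda>t. c *\<^sub>R f t) = \<bar>c\<bar> * N f"
begin

lemma N_zero: "N (\<lambda>t. 0) = 0"
  using N_scale[OF zero_mem, of 0] by simp

lemma diff_mem: "f \<in> V \<Longrightarrow> g \<in> V \<Longrightarrow> (\<lambda>t. f t - g t) \<in> V"
  using add_mem[of f "\<lambda>t. (-1) *\<^sub>R g t"] scale_mem[of g "-1"] by simp

lemma N_diff: "f \<in> V \<Longrightarrow> g \<in> V \<Longrightarrow> N (\<lambda>t. f t - g t) \<le> N f + N g"
  using N_add[of f "\<lambda>t. (-1) *\<^sub>R g t"] scale_mem[of g "-1"] N_scale[of g "-1"] by simp

lemma N_nonneg: "f \<in> V \<Longrightarrow> 0 \<le> N f"
  using N_diff[of f f] N_zero by simp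

lemma N_minus_commute: "f \<in> V \<Longrightarrow> g \<in> V \<Longrightarrow> N (\<lambda>t. f t - g t) = N (\<lambda>t. g t - f t)"
  using N_scale[OF diff_mem, of f g "-1"] by simp

lemma N_le_add_diff: "f \<in> V \<Longrightarrow> g \<in> V \<Longrightarrow> N f \<le> N g + N (\<lambda>t. f t - g t)"
  using N_add[OF _ diff_mem, of g f g] by simp

lemma N_triangle_diff:
  "f \<in> V \<Longrightarrow> g \<in> V \<Longrightarrow> h \<in> V \<Longrightarrow> N (\<lambda>t. f t - h t) \<le> N (\<lambda>t. f t - g t) + N (\<lambda>t. g t - h t)"
  using N_add[OF diff_mem diff_mem, of f g g h] by simp

lemma sum_mem: "(\<And>i. i \<in> I \<Longrightarrow> f i \<in> V) \<Longrightarrow> (\<lambda>t. \<Sum>i\<in>I. f i t) \<in> V"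
  by (induction I rule: infinite_finite_induct) (simp_all add: zero_mem add_mem)

lemma N_sum: "(\<And>i. i \<in> I \<Longrightarrow> f i \<in> V) \<Longrightarrow> N (\<lambda>t. \<Sum>i\<in>I. f i t) \<le> (\<Sum>i\<in>I. N (f i))"
proof (induction I rule: infinite_finite_induct)
  case (insert i I)
  then have "N (\<lambda>t. f i t + (\<Sum>i\<in>I. f i t)) \<le> N (f i) + N (\<lambda>t. \<Sum>i\<in>I. f i t)"
    by (intro N_add sum_mem) auto
  with insert show ?case by simp
qed (simp_all add: N_zero)

lemma linear_on_fun_sum:
  assumes "linear_on_fun V \<phi>" "\<And>i. i \<in> I \<Longrightarrow> f i \<in> V"
  shows "\<phi> (\<lambda>t. \<Sum>i\<in>I. f i t) = (\<Sum>i\<in>I. \<phi> (f i))"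
  using assms(2)
proof (induction I rule: infinite_finite_induct)
  have 0: "\<phi> (\<lambda>t. 0) = 0" using linear_on_fun_scale[OF assms(1) zero_mem, of 0] by simp
  { case empty then show ?case using 0 by simp }
  { case infinite then show ?case using 0 by simp }
  case (insert i I)
  then have "\<phi> (\<lambda>t. f i t + (\<Sum>i\<in>I. f i t)) = \<phi> (f i) + \<phi> (\<lambda>t. \<Sum>i\<in>I. f i t)"
    using assms(1) by (intro linear_on_fun_add) (auto intro!: sum_mem)
  with insert show ?case by simp
qed

lemma linear_on_fun_diff:
  assumes "linear_on_fun V \<phi>" "f \<in> V" "g \<in> V"
  shows "\<phi> (\<lambda>t. f t - g t) = \<phi> f - \<phi> g"
  using linear_on_fun_add[OF assms(1,2) scale_mem[OF assms(3), of "-1"]]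
    linear_on_fun_scale[OF assms(1,3), of "-1"] by simp

lemma fspan_subset: "A \<subseteq> V \<Longrightarrow> fspan A \<subseteq> V"
proof
  fix h assume "A \<subseteq> V" "h \<in> fspan A"
  then obtain c where "h = (\<lambda>t. \<Sum>a\<in>A. c a *\<^sub>R a t)" unfolding fspan_def by auto
  then show "h \<in> V" using \<open>A \<subseteq> V\<close> by (auto intro!: sum_mem scale_mem)
qed

text \<open>Replaces, without any compactness or linear independence, the equivalence of norms on a
  finite-dimensional space: the approximation error \<open>\<eta>\<close> absorbs the degenerate directions.\<close>
lemma approximate_coefficients:
  assumes "finite A" "A \<subseteq> V"
  shows "\<exists>C\<ge>0. \<forall>h\<in>fspan A. \<forall>\<eta>>0. \<exists>c. N (\<lambda>t. h t - (\<Sum>a\<in>A. c a *\<^sub>R a t)) \<le> \<eta>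
           \<and> (\<Sum>a\<in>A. \<bar>c a\<bar>) \<le> C * (N h + \<eta>)"
  using assms
proof (induction A)
  case empty
  then show ?case by (intro exI[of _ 0]) (auto simp: fspan_def N_zero fun_eq_iff[symmetric])
next
  case (insert b A)
  then have V: "A \<subseteq> V" "b \<in> V" by auto
  then have spV: "k \<in> fspan A \<Longrightarrow> k \<in> V" for k using fspan_subset by blast
  from insert obtain C where "C \<ge> 0" and
    C: "\<And>h \<eta>. h \<in> fspan A \<Longrightarrow> \<eta> > 0 \<Longrightarrow> \<exists>c. N (\<lambda>t. h t - (\<Sum>a\<in>A. c a *\<^sub>R a t)) \<le> \<eta>
           \<and> (\<Sum>a\<in>A. \<bar>c a\<bar>) \<le> C * (N h + \<eta>)"
    by blast
  have sum_upd: "(\<Sum>a\<in>insert b A. (c(b := r)) a *\<^sub>R a t) = r *\<^sub>R b t + (\<Sum>a\<in>A. c a *\<^sub>R a t)"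
    for c r t using insert.hyps by (auto intro!: sum.cong)
  have abs_upd: "(\<Sum>a\<in>insert b A. \<bar>(c(b := r)) a\<bar>) = \<bar>r\<bar> + (\<Sum>a\<in>A. \<bar>c a\<bar>)" for c r
  proof -
    have "(\<Sum>a\<in>A. \<bar>(c(b := r)) a\<bar>) = (\<Sum>a\<in>A. \<bar>c a\<bar>)"
      using insert.hyps by (intro sum.cong) auto
    then show ?thesis using insert.hyps by simp
  qed
  have split: "\<exists>r k. k \<in> fspan A \<and> h = (\<lambda>t. r *\<^sub>R b t + k t)" if "h \<in> fspan (insert b A)" for h
  proof -
    from that obtain c where c: "\<And>t. h t = (\<Sum>a\<in>insert b A. c a *\<^sub>R a t)"
      unfolding fspan_def by auto
    show ?thesis
    proof (intro exI conjI)
      show "(\<lambda>t. \<Sum>a\<in>A. c a *\<^sub>R a t) \<in> fspan A" unfolding fspan_def by auto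
      show "h = (\<lambda>t. c b *\<^sub>R b t + (\<Sum>a\<in>A. c a *\<^sub>R a t))"
        using insert.hyps by (simp add: c fun_eq_iff)
    qed
  qed
  have sp_comb: "(\<lambda>t. k t + r *\<^sub>R l t) \<in> fspan A" if "k \<in> fspan A" "l \<in> fspan A" for k l r
  proof -
    from that obtain c d where "\<And>t. k t = (\<Sum>a\<in>A. c a *\<^sub>R a t)" "\<And>t. l t = (\<Sum>a\<in>A. d a *\<^sub>R a t)"
      unfolding fspan_def by auto
    then have "\<forall>t. k t + r *\<^sub>R l t = (\<Sum>a\<in>A. (c a + r * d a) *\<^sub>R a t)"
      by (simp add: scaleR_add_left sum.distrib scaleR_sum_right)
    then show ?thesis unfolding fspan_def mem_Collect_eq
      by (intro exI[of _ "\<lambda>a. c a + r * d a"])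
  qed
  have sp_zero: "(\<lambda>t. 0) \<in> fspan A" unfolding fspan_def by (auto intro!: exI[of _ "\<lambda>_. 0"])
  \<comment> \<open>If \<open>b\<close> has positive distance \<open>d\<close> from the span of
    \<open>A\<close>, its coefficient in \<open>h\<close> is at most \<open>N h / d\<close>.
    Otherwise elements of that span come arbitrarily close to \<open>b\<close> and can replace
    it.\<close>
  show ?case
  proof (cases "\<exists>d>0. \<forall>k\<in>fspan A. d \<le> N (\<lambda>t. b t + k t)")
    case True
    then obtain d where d: "d > 0" "\<And>k. k \<in> fspan A \<Longrightarrow> d \<le> N (\<lambda>t. b t + k t)" by blast
    \<comment> \<open>The first summand controls the coefficients of \<open>k\<close> through
      \<open>N k \<le> N h * (1 + N b / d)\<close>, the second controls \<open>r\<close>.\<close>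
    define C' where "C' = C * (1 + N b / d) + 1 / d"
    have Nb: "0 \<le> N b" using V N_nonneg by blast
    have "C' \<ge> 0" using \<open>C \<ge> 0\<close> d(1) Nb by (simp add: C'_def)
    moreover have "\<exists>c. N (\<lambda>t. h t - (\<Sum>a\<in>insert b A. c a *\<^sub>R a t)) \<le> \<eta>
           \<and> (\<Sum>a\<in>insert b A. \<bar>c a\<bar>) \<le> C' * (N h + \<eta>)"
      if h: "h \<in> fspan (insert b A)" and "\<eta> > 0" for h \<eta>
    proof -
      obtain r k where k: "k \<in> fspan A" and hk: "h = (\<lambda>t. r *\<^sub>R b t + k t)" using split[OF h] by blast
      have kV: "k \<in> V" using spV k .
      have hV: "h \<in> V" unfolding hk by (intro add_mem scale_mem V kV)
      have rd: "\<bar>r\<bar> * d \<le> N h"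
      proof (cases "r = 0")
        case True then show ?thesis using N_nonneg[OF hV] by simp
      next
        case False
        have k': "(\<lambda>t. (1 / r) *\<^sub>R k t) \<in> fspan A" using sp_comb[OF sp_zero k, of "1/r"] by simp
        have "N h = N (\<lambda>t. r *\<^sub>R (b t + (1 / r) *\<^sub>R k t))"
          using False by (simp add: hk scaleR_add_right)
        also have "\<dots> = \<bar>r\<bar> * N (\<lambda>t. b t + (1 / r) *\<^sub>R k t)"
          using V spV[OF k'] by (intro N_scale add_mem)
        finally show ?thesis using d(2)[OF k'] by (simp add: mult_left_mono)
      qed
      then have r: "\<bar>r\<bar> \<le> N h / d" using d(1) by (simp add: field_simps)
      have "N k \<le> N h + N (\<lambda>t. r *\<^sub>R b t)"
        using N_diff[OF hV scale_mem[OF V(2), of r]] by (simp add: hk)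
      then have "N k \<le> N h + \<bar>r\<bar> * N b" using N_scale[OF V(2)] by simp
      also have "\<dots> \<le> N h + N h / d * N b" using r Nb by (intro add_left_mono mult_right_mono)
      finally have Nk: "N k \<le> N h * (1 + N b / d)" by (simp add: algebra_simps)
      obtain c where c: "N (\<lambda>t. k t - (\<Sum>a\<in>A. c a *\<^sub>R a t)) \<le> \<eta>"
        "(\<Sum>a\<in>A. \<bar>c a\<bar>) \<le> C * (N k + \<eta>)" using C[OF k \<open>\<eta> > 0\<close>] by blast
      have "C * (N k + \<eta>) \<le> C * ((N h + \<eta>) * (1 + N b / d))"
      proof (intro mult_left_mono \<open>C \<ge> 0\<close>)
        have "0 \<le> \<eta> * (N b / d)" using \<open>\<eta> > 0\<close> Nb d(1) by simp
        then show "N k + \<eta> \<le> (N h + \<eta>) * (1 + N b / d)"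
          using Nk by (simp add: distrib_right distrib_left add_divide_distrib)
      qed
      moreover have "N h / d \<le> 1 / d * (N h + \<eta>)"
        using d(1) \<open>\<eta> > 0\<close> by (simp add: divide_right_mono)
      ultimately have "\<bar>r\<bar> + (\<Sum>a\<in>A. \<bar>c a\<bar>) \<le> C' * (N h + \<eta>)"
        using r c(2) by (simp add: C'_def algebra_simps)
      then show ?thesis
        using c(1) by (intro exI[of _ "c(b := r)"]) (simp only: sum_upd abs_upd, simp add: hk)
    qed
    ultimately show ?thesis by blast
  next
    case False
    have "\<exists>c. N (\<lambda>t. h t - (\<Sum>a\<in>insert b A. c a *\<^sub>R a t)) \<le> \<eta>
           \<and> (\<Sum>a\<in>insert b A. \<bar>c a\<bar>) \<le> C * (N h + \<eta>)"
      if h: "h \<in> fspan (insert b A)" and "\<eta> > 0" for h \<eta>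
    proof -
      obtain r k where k: "k \<in> fspan A" and hk: "h = (\<lambda>t. r *\<^sub>R b t + k t)" using split[OF h] by blast
      have hV: "h \<in> V" unfolding hk by (intro add_mem scale_mem V spV k)
      \<comment> \<open>Replacing \<open>r *\<^sub>R b\<close> by an element of the span costs
        \<open>\<bar>r\<bar>\<close> times this tolerance, hence at most \<open>\<eta> / 2\<close>;
        the other half goes to the induction hypothesis. The \<open>1\<close> guards against
        \<open>r = 0\<close>.\<close>
      have "\<not> \<eta> / (2 * (\<bar>r\<bar> + 1)) \<le> 0" using \<open>\<eta> > 0\<close> by (simp add: not_le)
      then obtain k0 where k0: "k0 \<in> fspan A" "N (\<lambda>t. b t + k0 t) < \<eta> / (2 * (\<bar>r\<bar> + 1))"
        using False by (meson not_le)
      define l where "l = (\<lambda>t. k t + (- r) *\<^sub>R k0 t)"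
      have l: "l \<in> fspan A" unfolding l_def by (intro sp_comb k k0)
      have lV: "l \<in> V" using spV l .
      have "N (\<lambda>t. h t - l t) = N (\<lambda>t. r *\<^sub>R (b t + k0 t))"
        by (simp add: hk l_def scaleR_add_right)
      also have "\<dots> = \<bar>r\<bar> * N (\<lambda>t. b t + k0 t)"
        using V spV[OF k0(1)] by (intro N_scale add_mem)
      also have "\<dots> \<le> \<bar>r\<bar> * (\<eta> / (2 * (\<bar>r\<bar> + 1)))" using k0(2) by (intro mult_left_mono) auto
      also have "\<dots> \<le> \<eta> / 2" using \<open>\<eta> > 0\<close> by (simp add: field_simps)
      finally have hl: "N (\<lambda>t. h t - l t) \<le> \<eta> / 2" .
      obtain c where c: "N (\<lambda>t. l t - (\<Sum>a\<in>A. c a *\<^sub>R a t)) \<le> \<eta> / 2"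
        "(\<Sum>a\<in>A. \<bar>c a\<bar>) \<le> C * (N l + \<eta> / 2)" using C[OF l, of "\<eta> / 2"] \<open>\<eta> > 0\<close> by auto
      have "N l \<le> N h + \<eta> / 2" using N_le_add_diff[OF lV hV] N_minus_commute[OF lV hV] hl by simp
      then have "C * (N l + \<eta> / 2) \<le> C * (N h + \<eta>)" using \<open>C \<ge> 0\<close> by (intro mult_left_mono) auto
      moreover have "N (\<lambda>t. h t - (\<Sum>a\<in>A. c a *\<^sub>R a t)) \<le> \<eta>"
        using N_triangle_diff[OF hV lV sum_mem, of A "\<lambda>a t. c a *\<^sub>R a t"] hl c(1) V
        by (force intro: scale_mem)
      ultimately show ?thesis
        using c(2) by (intro exI[of _ "c(b := 0)"]) (simp only: sum_upd abs_upd, simp)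
    qed
    then show ?thesis using \<open>C \<ge> 0\<close> by blast
  qed
qed

end

section \<open>Norming weights in a positive cone\<close>

text \<open>If the dual norm of \<open>a\<close> is smaller than one, it is raised to almost one by enlarging
  the single weight \<open>a j\<close>; the vector \<open>b\<close> nearly norms the result.\<close>
lemma enlarge_to_norming_weights:
  fixes \<nu> :: "('i \<Rightarrow> real) \<Rightarrow> real" and a :: "'i \<Rightarrow> real"
  assumes I: "finite I" "j \<in> I"
    and hom: "\<And>c r. c \<in> C \<Longrightarrow> 0 \<le> r \<Longrightarrow> (\<lambda>i. r * c i) \<in> C \<and> \<nu> (\<lambda>i. r * c i) = r * \<nu> c"
    and nonneg: "\<And>c. c \<in> C \<Longrightarrow> 0 \<le> c j"
    and e: "e \<in> C" "e j = 1"
    and m: "0 < m" "\<And>c. c \<in> C \<Longrightarrow> m * c j \<le> \<nu> c"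
    and a: "\<And>c. c \<in> C \<Longrightarrow> (\<Sum>i\<in>I. a i * c i) \<le> \<nu> c"
    and "0 < \<epsilon>"
  shows "\<exists>a' b. (\<forall>i. a i \<le> a' i) \<and> (\<forall>c\<in>C. (\<Sum>i\<in>I. a' i * c i) \<le> \<nu> c) \<and>
           b \<in> C \<and> \<nu> b = 1 \<and> 1 - \<epsilon> \<le> (\<Sum>i\<in>I. a' i * b i)"
proof -
  \<comment> \<open>Step size for raising \<open>a j\<close>: a unit vector \<open>b\<close> of the
    cone satisfies \<open>m * b j \<le> 1\<close>, so one step changes its pairing by at most
    \<open>\<epsilon>\<close>.\<close>
  define \<eta> where "\<eta> = \<epsilon> * m"
  have "\<eta> > 0" using \<open>0 < \<epsilon>\<close> m by (simp add: \<eta>_def)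
  \<comment> \<open>\<open>P n\<close> says that the weights stay in the dual unit ball after
    \<open>n\<close> steps. It holds for \<open>0\<close> and fails at \<open>e\<close> for large
    \<open>n\<close>; the vector \<open>c\<close> that witnesses a failure right after a valid
    \<open>k\<close> yields \<open>b\<close>.\<close>
  define P where "P n \<longleftrightarrow> (\<forall>c\<in>C. (\<Sum>i\<in>I. a i * c i) + real n * \<eta> * c j \<le> \<nu> c)" for n :: nat
  have "P 0" using a by (simp add: P_def)
  obtain n :: nat where "\<nu> e - (\<Sum>i\<in>I. a i * e i) < real n * \<eta>"
    using reals_Archimedean3[OF \<open>\<eta> > 0\<close>] by blast
  then have "\<not> P n" using e by (force simp: P_def)
  then obtain k where "P k" "\<not> P (Suc k)" using \<open>P 0\<close> by (induction n) auto
  then obtain c where c: "c \<in> C" "\<nu> c < (\<Sum>i\<in>I. a i * c i) + real (Suc k) * \<eta> * c j"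
    by (auto simp: P_def not_le)
  define a' where "a' = a(j := a j + real k * \<eta>)"
  have a'_sum: "(\<Sum>i\<in>I. a' i * d i) = (\<Sum>i\<in>I. a i * d i) + real k * \<eta> * d j" for d
    using I by (simp add: a'_def sum.remove[of I j] algebra_simps)
  have a'_le: "(\<Sum>i\<in>I. a' i * d i) \<le> \<nu> d" if "d \<in> C" for d
    using \<open>P k\<close> that by (simp add: a'_sum P_def)
  have *: "\<nu> c < (\<Sum>i\<in>I. a' i * c i) + \<eta> * c j"
    using c(2) by (simp add: a'_sum algebra_simps)
  \<comment> \<open>Otherwise the added term vanishes and \<open>*\<close> contradicts
    \<open>a'_le\<close>.\<close>
  have "c j > 0"
    using * a'_le[OF c(1)] nonneg[OF c(1)] \<open>\<eta> > 0\<close> by (cases "c j = 0") auto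
  then have "0 < m * c j" using m(1) by simp
  then have "\<nu> c > 0" using m(2)[OF c(1)] by linarith
  define b where "b = (\<lambda>i. (1 / \<nu> c) * c i)"
  have b: "b \<in> C" "\<nu> b = 1"
    using hom[OF c(1), of "1 / \<nu> c"] \<open>\<nu> c > 0\<close> by (auto simp: b_def)
  have "m * b j \<le> 1" using m(2)[OF b(1)] b(2) by simp
  then have "\<eta> * b j \<le> \<epsilon>" using \<open>0 < \<epsilon>\<close> by (simp add: \<eta>_def mult.assoc mult_left_le)
  moreover have "(\<Sum>i\<in>I. a' i * b i) = (\<Sum>i\<in>I. a' i * c i) / \<nu> c"
    by (simp add: b_def sum_divide_distrib)
  moreover have "1 < (\<Sum>i\<in>I. a' i * c i) / \<nu> c + \<eta> * b j"
    using * \<open>\<nu> c > 0\<close> by (simp add: b_def field_simps)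
  ultimately have "1 - \<epsilon> \<le> (\<Sum>i\<in>I. a' i * b i)" by linarith
  moreover have "\<forall>i. a i \<le> a' i" using \<open>\<eta> > 0\<close> by (simp add: a'_def)
  ultimately show ?thesis using b a'_le by blast
qed

section \<open>Bochner measurability\<close>

text \<open>Modification on a null set changes each preimage by a null set, and completeness makes
  the result measurable.\<close>

lemma (in complete_measure) measurable_AE_eq:
  assumes g: "g \<in> measurable M N" and f: "f \<in> space M \<rightarrow> space N" and eq: "AE x in M. f x = g x"
  shows "f \<in> measurable M N"
proof (rule measurableI)
  show "f x \<in> space N" if "x \<in> space M" for x using f that by auto
  fix A assume "A \<in> sets N"
  then have A: "g -` A \<inter> space M \<in> sets M" using g by (rule measurable_sets[rotated])
  have "AE x in M. x \<in> g -` A \<inter> space M \<longleftrightarrow> x \<in> f -` A \<inter> space M" using eq by eventually_elim auto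
  then show "f -` A \<inter> space M \<in> sets M" using A by (rule in_sets_AE) auto
qed

lemma borel_measurable_simple_bochner:
  "Bochner_Integration.simple_bochner_integrable M f \<Longrightarrow> f \<in> borel_measurable M"
  by (auto elim!: simple_bochner_integrable.cases intro: borel_measurable_simple_function)

text \<open>Setting the approximating functions and \<open>f\<close> to zero on the null set without
  convergence makes the limit hold everywhere; completeness carries measurability back to
  \<open>f\<close>.\<close>

lemma (in complete_measure) bochner_measurable_imp_borel:
  fixes f :: "'a \<Rightarrow> 'x::real_normed_vector"
  assumes "bochner_measurable M f" shows "f \<in> borel_measurable M"
proof -
  obtain s where s: "\<And>n. Bochner_Integration.simple_bochner_integrable M (s n)"
    and lim: "AE x in M. (\<lambda>n. s n x) \<longlonglongrightarrow> f x"
    using assms unfolding bochner_measurable_def by blast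
  define Z where "Z = {x \<in> space M. \<not> (\<lambda>n. s n x) \<longlonglongrightarrow> f x}"
  have Z: "Z \<in> null_sets M" using lim unfolding Z_def AE_iff_null_sets .
  define f' where "f' x = (if x \<in> Z then 0 else f x)" for x
  have "f' \<in> borel_measurable M"
  proof (rule borel_measurable_LIMSEQ_metric)
    have "Z \<inter> space M \<in> sets M" using Z by auto
    then show "(\<lambda>x. if x \<in> Z then 0 else s n x) \<in> borel_measurable M" for n
      using borel_measurable_simple_bochner[OF s] by (intro measurable_If_set) auto
    show "(\<lambda>n. if x \<in> Z then 0 else s n x) \<longlonglongrightarrow> f' x" if "x \<in> space M" for x
      using that by (auto simp: f'_def Z_def)
  qed
  moreover have "AE x in M. f x = f' x"
    using AE_not_in[OF Z] by eventually_elim (simp add: f'_def)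
  ultimately show ?thesis using measurable_AE_eq[of f' borel f] by auto
qed

lemma bochner_measurable_simple:
  "Bochner_Integration.simple_bochner_integrable M f \<Longrightarrow> bochner_measurable M f"
  unfolding bochner_measurable_def by (intro exI[of _ "\<lambda>_. f"]) auto

lemma bochner_measurable_add:
  assumes "bochner_measurable M f" "bochner_measurable M g"
  shows "bochner_measurable M (\<lambda>t. f t + g t)"
proof -
  obtain s s' where s: "\<And>n. Bochner_Integration.simple_bochner_integrable M (s n)"
      "\<And>n. Bochner_Integration.simple_bochner_integrable M (s' n)"
    and lim: "AE x in M. (\<lambda>n. s n x) \<longlonglongrightarrow> f x" "AE x in M. (\<lambda>n. s' n x) \<longlonglongrightarrow> g x"
    using assms unfolding bochner_measurable_def by blast
  have "AE x in M. (\<lambda>n. s n x + s' n x) \<longlonglongrightarrow> f x + g x"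
    using lim by eventually_elim (rule tendsto_add)
  then show ?thesis
    unfolding bochner_measurable_def
    by (intro exI[of _ "\<lambda>n x. s n x + s' n x"]) (auto intro!: simple_bochner_integrable_compose2[where p = "(+)"] s)
qed

lemma simple_bochner_integrable_compose:
  "Bochner_Integration.simple_bochner_integrable M f \<Longrightarrow> p 0 = 0 \<Longrightarrow>
    Bochner_Integration.simple_bochner_integrable M (\<lambda>x. p (f x))"
  using simple_bochner_integrable_compose2[of "\<lambda>x y. p x" M f f] by simp

lemma bochner_measurable_scale:
  assumes "bochner_measurable M f"
  shows "bochner_measurable M (\<lambda>t. c *\<^sub>R f t)"
proof -
  obtain s where s: "\<And>n. Bochner_Integration.simple_bochner_integrable M (s n)"
    and lim: "AE x in M. (\<lambda>n. s n x) \<longlonglongrightarrow> f x"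
    using assms unfolding bochner_measurable_def by blast
  have "AE x in M. (\<lambda>n. c *\<^sub>R s n x) \<longlonglongrightarrow> c *\<^sub>R f x"
    using lim by eventually_elim (intro tendsto_intros)
  then show ?thesis
    unfolding bochner_measurable_def
    by (intro exI[of _ "\<lambda>n x. c *\<^sub>R s n x"])
       (auto intro!: simple_bochner_integrable_compose[where p = "\<lambda>x. c *\<^sub>R x"] s)
qed

lemma simple_bochner_integrable_indicator_scale:
  assumes "A \<in> sets M" "emeasure M A < \<infinity>"
  shows "Bochner_Integration.simple_bochner_integrable M (\<lambda>t. indicator A t *\<^sub>R x)"
proof -
  have "Bochner_Integration.simple_bochner_integrable M (indicator A :: _ \<Rightarrow> real)"
  proof
    have "{y \<in> space M. (indicator A y :: real) \<noteq> 0} = A"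
      using assms(1) sets.sets_into_space by (auto simp: indicator_def)
    then show "emeasure M {y \<in> space M. (indicator A y :: real) \<noteq> 0} \<noteq> \<infinity>" using assms by simp
  qed (use assms in simp)
  then show ?thesis by (rule simple_bochner_integrable_compose) simp
qed

section \<open>Local octahedrality of Koethe-Bochner spaces\<close>

text \<open>Only the lattice part of the axioms of a Koethe function space, so that for \<open>L\<^sup>p\<close> it is enough
  to know Minkowski's inequality.\<close>
locale koethe_lattice = complete_measure M for M :: "'s measure" +
  fixes E :: "('s \<Rightarrow> real) set" and NE :: "('s \<Rightarrow> real) \<Rightarrow> real"
  assumes E_borel: "f \<in> E \<Longrightarrow> f \<in> borel_measurable M"
    and E_add: "f \<in> E \<Longrightarrow> g \<in> E \<Longrightarrow> (\<lambda>x. f x + g x) \<in> E"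
    and E_scale: "f \<in> E \<Longrightarrow> (\<lambda>x. c * f x) \<in> E"
    and E_indicator: "A \<in> sets M \<Longrightarrow> emeasure M A < \<infinity> \<Longrightarrow> indicator A \<in> E"
    and E_ideal: "f \<in> E \<Longrightarrow> g \<in> borel_measurable M \<Longrightarrow> AE x in M. \<bar>g x\<bar> \<le> \<bar>f x\<bar> \<Longrightarrow> g \<in> E"
    and NE_mono: "f \<in> E \<Longrightarrow> g \<in> borel_measurable M \<Longrightarrow> AE x in M. \<bar>g x\<bar> \<le> \<bar>f x\<bar> \<Longrightarrow> NE g \<le> NE f"
    and NE_add: "f \<in> E \<Longrightarrow> g \<in> E \<Longrightarrow> NE (\<lambda>x. f x + g x) \<le> NE f + NE g"
    and NE_scale: "f \<in> E \<Longrightarrow> NE (\<lambda>x. c * f x) = \<bar>c\<bar> * NE f"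
    and NE_definite: "f \<in> E \<Longrightarrow> NE f = 0 \<Longrightarrow> AE x in M. f x = 0"

lemma koethe_space_imp_lattice:
  assumes "complete_measure M" "koethe_space M E NE"
  shows "koethe_lattice M E NE"
proof -
  note K = assms(2)[unfolded koethe_space_def]
  have K1: "E \<subseteq> borel_measurable M"
    "\<forall>f\<in>E. \<forall>g\<in>E. (\<lambda>x. f x + g x) \<in> E \<and> NE (\<lambda>x. f x + g x) \<le> NE f + NE g"
    "\<forall>f\<in>E. \<forall>c::real. (\<lambda>x. c * f x) \<in> E \<and> NE (\<lambda>x. c * f x) = \<bar>c\<bar> * NE f"
    "\<forall>f\<in>E. NE f = 0 \<longrightarrow> (AE x in M. f x = 0)"
    "\<forall>A\<in>sets M. emeasure M A < \<infinity> \<longrightarrow> indicator A \<in> E"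
    "\<forall>f\<in>E. \<forall>g\<in>borel_measurable M. (AE x in M. \<bar>g x\<bar> \<le> \<bar>f x\<bar>) \<longrightarrow> g \<in> E \<and> NE g \<le> NE f"
    using K by - (elim conjE, assumption)+
  show ?thesis
    by (intro koethe_lattice.intro assms(1) koethe_lattice_axioms.intro) (use K1 in auto)
qed

context koethe_lattice
begin

abbreviation KN :: "('s \<Rightarrow> 'x::real_normed_vector) \<Rightarrow> real"
  where "KN \<equiv> kothe_bochner_norm NE"

abbreviation KB :: "('s \<Rightarrow> 'x::real_normed_vector) set"
  where "KB \<equiv> kothe_bochner M E"

lemma KB_norm_mem: "f \<in> KB \<Longrightarrow> (\<lambda>x. norm (f x)) \<in> E"
  by (simp add: kothe_bochner_def)

text \<open>The norm is bounded by a multiple of the indicator of the support, which has finite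
  measure, so the ideal property applies.\<close>

lemma simple_mem_KB:
  fixes f :: "'s \<Rightarrow> 'x::real_normed_vector"
  assumes "Bochner_Integration.simple_bochner_integrable M f"
  shows "f \<in> KB"
proof -
  have sf: "simple_function M f" and fin: "emeasure M {x \<in> space M. f x \<noteq> 0} \<noteq> \<infinity>"
    using assms by (auto elim: simple_bochner_integrable.cases)
  define S where "S = {x \<in> space M. f x \<noteq> 0}"
  have "S = space M - f -` {0} \<inter> space M" by (auto simp: S_def)
  then have S: "S \<in> sets M" using simple_functionD(2)[OF sf, of "{0}"] by auto
  \<comment> \<open>Inserting \<open>0\<close> keeps the maximum defined when \<open>space M\<close>
    is empty.\<close>
  define K where "K = Max (insert 0 ((norm \<circ> f) ` space M))"
  have "finite ((norm \<circ> f) ` space M)"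
    using simple_functionD(1)[OF sf] by (metis finite_imageI image_comp)
  then have K: "norm (f x) \<le> K" if "x \<in> space M" for x
    using that unfolding K_def by (intro Max_ge) auto
  have "(\<lambda>x. K * indicator S x) \<in> E" using E_scale[OF E_indicator[OF S]] fin by (simp add: S_def less_top)
  moreover have "(\<lambda>x. norm (f x)) \<in> borel_measurable M"
    using borel_measurable_simple_bochner[OF assms] by measurable
  moreover have "AE x in M. \<bar>norm (f x)\<bar> \<le> \<bar>K * indicator S x\<bar>"
    using K by (intro AE_I2) (fastforce simp: S_def indicator_def)
  ultimately have "(\<lambda>x. norm (f x)) \<in> E" by (rule E_ideal)
  then show ?thesis using bochner_measurable_simple[OF assms] by (simp add: kothe_bochner_def)
qed

lemma KB_norm_measurable: "f \<in> KB \<Longrightarrow> (\<lambda>x. norm (f x)) \<in> borel_measurable M"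
  using E_borel KB_norm_mem by blast

text \<open>Simple functions are unrestricted outside \<open>space M\<close>; this permits resetting
  them to zero there.\<close>

lemma KN_AE_cong:
  assumes "f \<in> KB" "g \<in> KB" "AE x in M. f x = g x"
  shows "KN f = KN g"
proof (rule antisym)
  show "KN f \<le> KN g" unfolding kothe_bochner_norm_def
    using assms(3) by (intro NE_mono KB_norm_mem assms KB_norm_measurable) (auto elim: eventually_mono)
  show "KN g \<le> KN f" unfolding kothe_bochner_norm_def
    using assms(3) by (intro NE_mono KB_norm_mem assms KB_norm_measurable) (auto elim: eventually_mono)
qed

text \<open>Membership of a sum and the triangle inequality both come from domination by
  \<open>norm (f t) + norm (g t)\<close>.\<close>

lemma function_seminorm_KB: "function_seminorm (KB :: ('s \<Rightarrow> 'x::real_normed_vector) set) KN"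
proof
  show "(\<lambda>t. 0) \<in> KB"
    using simple_bochner_integrable_indicator_scale[of "{}" M 0] by (intro simple_mem_KB) simp
  fix f :: "'s \<Rightarrow> 'x" assume f: "f \<in> KB"
  show "(\<lambda>t. c *\<^sub>R f t) \<in> KB" for c
    using f E_scale[of "\<lambda>x. norm (f x)" "\<bar>c\<bar>"] by (simp add: kothe_bochner_def bochner_measurable_scale)
  show "KN (\<lambda>t. c *\<^sub>R f t) = \<bar>c\<bar> * KN f" for c
    using NE_scale[OF KB_norm_mem[OF f], of "\<bar>c\<bar>"] by (simp add: kothe_bochner_norm_def)
  fix g :: "'s \<Rightarrow> 'x" assume g: "g \<in> KB"
  have bm: "bochner_measurable M (\<lambda>t. f t + g t)"
    using f g by (simp add: kothe_bochner_def bochner_measurable_add)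
  have nb: "(\<lambda>t. norm (f t + g t)) \<in> borel_measurable M"
    using bochner_measurable_imp_borel[OF bm] by measurable
  have sum: "(\<lambda>t. norm (f t) + norm (g t)) \<in> E" using f g by (intro E_add KB_norm_mem)
  have le: "AE t in M. \<bar>norm (f t + g t)\<bar> \<le> \<bar>norm (f t) + norm (g t)\<bar>"
    by (intro AE_I2) (simp add: norm_triangle_ineq)
  show "(\<lambda>t. f t + g t) \<in> KB"
    using bm E_ideal[OF sum nb le] by (simp add: kothe_bochner_def)
  have "KN (\<lambda>t. f t + g t) \<le> NE (\<lambda>t. norm (f t) + norm (g t))"
    unfolding kothe_bochner_norm_def using NE_mono[OF sum nb le] .
  also have "\<dots> \<le> KN f + KN g"
    unfolding kothe_bochner_norm_def using f g by (intro NE_add KB_norm_mem)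
  finally show "KN (\<lambda>t. f t + g t) \<le> KN f + KN g" .
qed

text \<open>Sigma-finiteness and positive measure give a nonnull set of finite measure, and
  definiteness of \<open>NE\<close> makes its indicator times \<open>y\<close> nonzero. This
  provides a unit vector even when the data at hand have norm zero.\<close>

lemma exists_KN_pos:
  fixes y :: "'x::real_normed_vector"
  assumes "sigma_finite_measure M" "emeasure M (space M) > 0" "norm y = 1"
  shows "\<exists>d :: 's \<Rightarrow> 'x. d \<in> KB \<and> KN d > 0"
proof -
  interpret sigma_finite_measure M by fact
  interpret function_seminorm "KB :: ('s \<Rightarrow> 'x) set" KN by (rule function_seminorm_KB)
  obtain A :: "nat \<Rightarrow> 's set" where A: "range A \<subseteq> sets M" "(\<Union>i. A i) = space M"
    "\<And>i. emeasure M (A i) \<noteq> \<infinity>" using sigma_finite by blast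
  have "\<exists>i. A i \<notin> null_sets M"
  proof (rule ccontr)
    assume "\<nexists>i. A i \<notin> null_sets M"
    then have "(\<Union>i. A i) \<in> null_sets M" by (intro null_sets_UN) auto
    then show False using A(2) assms(2) by auto
  qed
  then obtain i where i: "A i \<notin> null_sets M" by blast
  define D where "D = A i"
  have D: "D \<in> sets M" "emeasure M D < \<infinity>" "D \<notin> null_sets M"
    using A i by (auto simp: D_def less_top)
  define d where "d = (\<lambda>t. indicator D t *\<^sub>R y)"
  have d: "d \<in> KB" unfolding d_def by (intro simple_mem_KB simple_bochner_integrable_indicator_scale D)
  have "KN d \<noteq> 0"
  proof
    assume "KN d = 0"
    then have "AE x in M. norm (d x) = 0"
      using KB_norm_mem[OF d] by (intro NE_definite) (auto simp: kothe_bochner_norm_def)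
    then have "AE x in M. x \<notin> D"
      by eventually_elim (use assms(3) in \<open>auto simp: d_def indicator_def split: if_splits\<close>)
    then show False using D sets.sets_into_space[of D M] by (simp add: null_sets_iff_AE)
  qed
  then show ?thesis using d N_nonneg[OF d] by (intro exI[of _ d]) auto
qed

text \<open>With weights proportional to \<open>norm (u t)\<close>, the octahedral bound in
  \<open>X\<close> becomes, at every point, one and the same multiple of \<open>norm (u t)\<close>.
  Monotonicity and homogeneity of \<open>NE\<close> then settle the simple case.\<close>

lemma LOH_kothe_bochner:
  assumes "LOH TYPE('x::real_normed_vector)" "simple_dense M E NE TYPE('x)"
    "sigma_finite_measure M" "emeasure M (space M) > 0"
  shows "LOH_fun (KB :: ('s \<Rightarrow> 'x) set) KN"
  unfolding LOH_fun_def
proof (intro ballI allI impI)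
  fix f :: "'s \<Rightarrow> 'x" and \<epsilon> :: real assume f: "f \<in> KB" and "\<epsilon> > 0"
  interpret function_seminorm "KB :: ('s \<Rightarrow> 'x) set" KN by (rule function_seminorm_KB)
  have Y: "\<exists>y::'x. norm y = 1 \<and> (\<forall>s. norm (s *\<^sub>R x + y) \<ge> (1 - \<delta>) * (\<bar>s\<bar> * norm x + 1))"
    if "\<delta> > 0" for x :: 'x and \<delta>
    using assms(1) that unfolding LOH_def by blast
  \<comment> \<open>The values \<open>1\<close> and \<open>0\<close> are arbitrary: the point is
    that \<open>X\<close> has a unit vector.\<close>
  obtain y0 :: 'x where "norm y0 = 1" using Y[of 1 0] by auto
  \<comment> \<open>One \<open>\<delta>\<close> is lost in the choice of \<open>y\<close>, the other
    in replacing \<open>f\<close> by a simple function.\<close>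
  define \<delta> where "\<delta> = min \<epsilon> 1 / 2"
  have \<delta>: "0 < \<delta>" "\<delta> < 1" "2 * \<delta> \<le> \<epsilon>" using \<open>\<epsilon> > 0\<close> by (auto simp: \<delta>_def)
  show "\<exists>g\<in>KB. KN g = 1 \<and> (\<forall>s. (1 - \<epsilon>) * (\<bar>s\<bar> * KN f + 1) \<le> KN (\<lambda>t. s *\<^sub>R f t + g t))"
  proof (cases "KN f = 0")
    \<comment> \<open>Here \<open>f\<close> is zero in the quotient, so any unit vector
      serves.\<close>
    case True
    obtain d :: "'s \<Rightarrow> 'x" where d: "d \<in> KB" "KN d > 0"
      using exists_KN_pos[OF assms(3,4) \<open>norm y0 = 1\<close>] by blast
    define g where "g = (\<lambda>t. (1 / KN d) *\<^sub>R d t)"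
    have g: "g \<in> KB" "KN g = 1" using d N_scale[of d "1 / KN d"] by (auto simp: g_def intro!: scale_mem)
    have "1 - \<epsilon> \<le> KN (\<lambda>t. s *\<^sub>R f t + g t)" for s
      using N_le_add_diff[OF g(1) add_mem[OF scale_mem[OF f, of s] g(1)]]
        N_scale[OF f, of "-s"] True g(2) \<open>\<epsilon> > 0\<close> by simp
    then show ?thesis using g True by auto
  next
    case False
    then have "KN f > 0" using N_nonneg[OF f] by simp
    \<comment> \<open>The accuracy is relative to \<open>KN f\<close>, since the error is multiplied
      by \<open>\<bar>s\<bar>\<close> and must be absorbed by
      \<open>\<bar>s\<bar> * KN f\<close>.\<close>
    then have "\<delta> * KN f / 2 > 0" using \<delta>(1) by simp
    then obtain u where u: "Bochner_Integration.simple_bochner_integrable M u"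
      and fu: "KN (\<lambda>t. f t - u t) < \<delta> * KN f / 2"
      using assms(2) f unfolding simple_dense_def by blast
    have uKB: "u \<in> KB" using simple_mem_KB[OF u] .
    have "KN f \<le> KN u + \<delta> * KN f / 2" using N_le_add_diff[OF f uKB] fu by simp
    moreover have "\<delta> * KN f < KN f" using \<delta> \<open>KN f > 0\<close> by simp
    ultimately have "KN u > 0" using \<open>KN f > 0\<close> by linarith
    \<comment> \<open>The choice depends on the value \<open>x\<close> only, so \<open>g\<close>
      below is a function of \<open>u\<close> and hence simple.\<close>
    define y where "y x = (SOME y::'x. norm y = 1 \<and>
        (\<forall>s. norm (s *\<^sub>R x + y) \<ge> (1 - \<delta>) * (\<bar>s\<bar> * norm x + 1)))" for x :: 'x
    have y: "norm (y x) = 1" "norm (s *\<^sub>R x + y x) \<ge> (1 - \<delta>) * (\<bar>s\<bar> * norm x + 1)" for x s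
      using someI_ex[OF Y[OF \<delta>(1), of x]] unfolding y_def by auto
    define g where "g = (\<lambda>t. (norm (u t) / KN u) *\<^sub>R y (u t))"
    have g: "g \<in> KB" unfolding g_def
      by (intro simple_mem_KB
          simple_bochner_integrable_compose[OF u, of "\<lambda>x. (norm x / KN u) *\<^sub>R y x"]) simp
    have "KN g = NE (\<lambda>t. (1 / KN u) * norm (u t))"
      unfolding kothe_bochner_norm_def[of NE g] using \<open>KN u > 0\<close> y(1) by (simp add: g_def)
    also have "\<dots> = 1"
      using NE_scale[OF KB_norm_mem[OF uKB], of "1 / KN u"] \<open>KN u > 0\<close> by (simp add: kothe_bochner_norm_def)
    finally have "KN g = 1" .
    have "(1 - \<epsilon>) * (\<bar>s\<bar> * KN f + 1) \<le> KN (\<lambda>t. s *\<^sub>R f t + g t)" for s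
    proof -
      define r where "r = (1 - \<delta>) * (\<bar>s\<bar> + 1 / KN u)"
      have pt: "r * norm (u t) \<le> norm (s *\<^sub>R u t + g t)" for t
      proof (cases "u t = 0")
        case False
        define c where "c = norm (u t) / KN u"
        have "c > 0" using False \<open>KN u > 0\<close> by (simp add: c_def)
        \<comment> \<open>The property of \<open>y\<close> is used at \<open>s / c\<close> and
          multiplied by \<open>c\<close>, which turns \<open>y (u t)\<close> into
          \<open>g t\<close>.\<close>
        have "r * norm (u t) = c * ((1 - \<delta>) * (\<bar>s / c\<bar> * norm (u t) + 1))"
          using \<open>c > 0\<close> \<open>KN u > 0\<close> by (simp add: r_def c_def abs_mult field_simps)
        also have "\<dots> \<le> c * norm ((s / c) *\<^sub>R u t + y (u t))"
          using \<open>c > 0\<close> y(2)[of "s / c" "u t"] by (intro mult_left_mono) auto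
        also have "\<dots> = norm (c *\<^sub>R ((s / c) *\<^sub>R u t + y (u t)))" using \<open>c > 0\<close> by simp
        also have "\<dots> = norm (s *\<^sub>R u t + g t)"
          using \<open>c > 0\<close> \<open>KN u > 0\<close> unfolding scaleR_add_right by (simp add: g_def c_def)
        finally show ?thesis .
      qed simp
      have r_KN: "r * KN u = (1 - \<delta>) * (\<bar>s\<bar> * KN u + 1)"
        using \<open>KN u > 0\<close> by (simp add: r_def field_simps)
      have r0: "0 \<le> r" using \<delta> \<open>KN u > 0\<close> by (simp add: r_def)
      have sug: "(\<lambda>t. s *\<^sub>R u t + g t) \<in> KB" by (intro add_mem scale_mem g uKB)
      have "r * KN u = NE (\<lambda>t. r * norm (u t))"
        using NE_scale[OF KB_norm_mem[OF uKB]] r0 by (simp add: kothe_bochner_norm_def)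
      also have "\<dots> \<le> KN (\<lambda>t. s *\<^sub>R u t + g t)"
        unfolding kothe_bochner_norm_def
      proof (rule NE_mono[OF KB_norm_mem[OF sug]])
        show "(\<lambda>t. r * norm (u t)) \<in> borel_measurable M" using KB_norm_measurable[OF uKB] by measurable
        show "AE t in M. \<bar>r * norm (u t)\<bar> \<le> \<bar>norm (s *\<^sub>R u t + g t)\<bar>"
          using pt r0 by (intro AE_I2) simp
      qed
      also have "\<dots> \<le> KN (\<lambda>t. s *\<^sub>R f t + g t) + \<bar>s\<bar> * KN (\<lambda>t. f t - u t)"
        using N_le_add_diff[OF sug add_mem[OF scale_mem[OF f, of s] g]]
          N_scale[OF diff_mem[OF f uKB], of "-s"] by (simp add: algebra_simps)
      finally have 1: "(1 - \<delta>) * (\<bar>s\<bar> * KN u + 1)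
          \<le> KN (\<lambda>t. s *\<^sub>R f t + g t) + \<bar>s\<bar> * KN (\<lambda>t. f t - u t)"
        using r_KN by simp
      have "\<bar>s\<bar> * KN (\<lambda>t. f t - u t) \<le> \<bar>s\<bar> * (\<delta> * KN f / 2)" using fu by (intro mult_left_mono) auto
      \<comment> \<open>The errors from \<open>KN u\<close> against \<open>KN f\<close> and from
        \<open>f - u\<close> are each at most \<open>\<delta> * KN f / 2\<close>; together they make
        up the second \<open>\<delta>\<close>.\<close>
      moreover have "\<bar>s\<bar> * ((1 - \<delta>) * KN f - \<delta> * KN f / 2) \<le> \<bar>s\<bar> * ((1 - \<delta>) * KN u)"
      proof (intro mult_left_mono)
        have "(1 - \<delta>) * (KN f - \<delta> * KN f / 2) \<le> (1 - \<delta>) * KN u"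
          using \<open>KN f \<le> KN u + \<delta> * KN f / 2\<close> \<delta> by (intro mult_left_mono) auto
        moreover have "0 \<le> \<delta> * (\<delta> * KN f / 2)" using \<delta> \<open>KN f > 0\<close> by simp
        ultimately show "(1 - \<delta>) * KN f - \<delta> * KN f / 2 \<le> (1 - \<delta>) * KN u"
          by (simp add: field_simps)
      qed simp
      ultimately have "(1 - 2 * \<delta>) * (\<bar>s\<bar> * KN f + 1) \<le> KN (\<lambda>t. s *\<^sub>R f t + g t)"
        using 1 \<delta>(1) by (simp add: algebra_simps)
      moreover have "(1 - \<epsilon>) * (\<bar>s\<bar> * KN f + 1) \<le> (1 - 2 * \<delta>) * (\<bar>s\<bar> * KN f + 1)"
        using \<delta>(3) \<open>KN f > 0\<close> by (intro mult_right_mono) auto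
      ultimately show ?thesis by linarith
    qed
    then show ?thesis using g \<open>KN g = 1\<close> by blast
  qed
qed

end

section \<open>Weak octahedrality of Koethe-Bochner spaces\<close>

text \<open>\<open>\<kappa>\<close> collects the values of finitely many simple functions at once, so that a
  finite-dimensional space of simple functions consists of functions \<open>H \<circ> \<kappa>\<close>.\<close>
locale finite_cells = koethe_lattice M E NE for M :: "'s measure" and E NE +
  fixes \<kappa> :: "'s \<Rightarrow> 'i" and i0 :: 'i
  assumes finite_range: "finite (range \<kappa>)"
    and cell_sets: "i \<noteq> i0 \<Longrightarrow> \<kappa> -` {i} \<in> sets M"
    and cell_finite: "i \<noteq> i0 \<Longrightarrow> emeasure M (\<kappa> -` {i}) < \<infinity>"
begin

text \<open>The label \<open>i0\<close> marks where all functions under consideration vanish. Its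
  cell contains every point outside \<open>space M\<close> and may have infinite measure, so it is
  left out.\<close>

definition I :: "'i set" where "I = range \<kappa> - {i0}"

definition cell :: "'i \<Rightarrow> 'x::real_normed_vector \<Rightarrow> 's \<Rightarrow> 'x"
  where "cell i x t = (if \<kappa> t = i then x else 0)"

definition weight :: "'i \<Rightarrow> real" where "weight i = NE (indicator (\<kappa> -` {i}))"

lemma finite_I: "finite I"
  using finite_range by (simp add: I_def)

lemma comp_simple:
  assumes "H i0 = 0" shows "Bochner_Integration.simple_bochner_integrable M (\<lambda>t. H (\<kappa> t))"
proof
  have U: "(\<Union>i\<in>I. \<kappa> -` {i}) \<in> fmeasurable M"
    by (intro fmeasurable.finite_UN finite_I) (use cell_sets cell_finite in \<open>auto simp: I_def fmeasurable_def\<close>)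
  have cell: "\<kappa> -` {i} \<inter> space M \<in> sets M" for i
  proof (cases "i = i0")
    \<comment> \<open>Inside the space, the exceptional cell is the complement of the finitely many
      others.\<close>
    case True
    have "\<kappa> -` {i0} \<inter> space M = space M - (\<Union>i\<in>I. \<kappa> -` {i})" by (auto simp: I_def)
    then show ?thesis using U True by auto
  qed (simp add: cell_sets sets.Int)
  show "simple_function M (\<lambda>t. H (\<kappa> t))"
    unfolding simple_function_def
  proof safe
    show "finite ((\<lambda>t. H (\<kappa> t)) ` space M)"
      using finite_range by (rule finite_surj[of _ _ H]) auto
    fix x
    have "(\<lambda>t. H (\<kappa> t)) -` {H (\<kappa> x)} \<inter> space M =
        (\<Union>i\<in>{i \<in> range \<kappa>. H i = H (\<kappa> x)}. \<kappa> -` {i} \<inter> space M)" by auto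
    also have "\<dots> \<in> sets M" using finite_range cell by (intro sets.finite_UN) auto
    finally show "(\<lambda>t. H (\<kappa> t)) -` {H (\<kappa> x)} \<inter> space M \<in> sets M" .
  qed
  have "emeasure M {y \<in> space M. H (\<kappa> y) \<noteq> 0} \<le> emeasure M (\<Union>i\<in>I. \<kappa> -` {i})"
    using U assms by (intro emeasure_mono) (auto simp: I_def fmeasurable_def)
  also have "\<dots> < \<infinity>" using U by (auto simp: fmeasurable_def)
  finally show "emeasure M {y \<in> space M. H (\<kappa> y) \<noteq> 0} \<noteq> \<infinity>" by simp
qed

lemma comp_KB: "H i0 = 0 \<Longrightarrow> (\<lambda>t. H (\<kappa> t)) \<in> KB"
  by (intro simple_mem_KB comp_simple)

lemma comp_E: "c i0 = 0 \<Longrightarrow> (\<lambda>t. c (\<kappa> t)) \<in> E" for c :: "'i \<Rightarrow> real"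
  by (rule E_ideal[OF KB_norm_mem[OF comp_KB[of c]]])
     (auto intro: borel_measurable_simple_bochner comp_simple)

lemma cell_KB: "i \<in> I \<Longrightarrow> cell i x \<in> KB"
  using comp_KB[of "\<lambda>k. if k = i then x else 0"] by (auto simp: cell_def[abs_def] I_def)

lemma KN_cell: "i \<in> I \<Longrightarrow> KN (cell i x) = norm x * weight i"
proof -
  assume "i \<in> I"
  then have "indicator (\<kappa> -` {i}) \<in> E" by (intro E_indicator cell_sets cell_finite) (auto simp: I_def)
  then have "NE (\<lambda>t. norm x * indicator (\<kappa> -` {i}) t) = norm x * weight i"
    using NE_scale[of _ "norm x"] by (simp add: weight_def)
  moreover have "(\<lambda>t. norm (cell i x t)) = (\<lambda>t. norm x * indicator (\<kappa> -` {i}) t)"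
    by (auto simp: cell_def fun_eq_iff indicator_def)
  ultimately show ?thesis by (simp add: kothe_bochner_norm_def)
qed

lemma weight_nonneg: "i \<in> I \<Longrightarrow> 0 \<le> weight i"
  using function_seminorm.N_nonneg[OF function_seminorm_KB cell_KB, of i "1::real"] KN_cell[of i "1::real"]
  by simp

lemma comp_eq_sum_cell: "H i0 = 0 \<Longrightarrow> (\<lambda>t. H (\<kappa> t)) = (\<lambda>t. \<Sum>i\<in>I. cell i (H i) t)"
  using finite_I by (auto simp: cell_def fun_eq_iff I_def)

lemma NE_comp_mono:
  fixes c d :: "'i \<Rightarrow> real"
  assumes "c i0 = 0" "d i0 = 0" "\<And>i. i \<in> I \<Longrightarrow> \<bar>c i\<bar> \<le> \<bar>d i\<bar>"
  shows "NE (\<lambda>t. c (\<kappa> t)) \<le> NE (\<lambda>t. d (\<kappa> t))"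
proof (intro NE_mono comp_E assms(2) AE_I2)
  show "(\<lambda>t. c (\<kappa> t)) \<in> borel_measurable M" using E_borel comp_E assms by blast
  show "\<bar>c (\<kappa> t)\<bar> \<le> \<bar>d (\<kappa> t)\<bar>" for t
    using assms by (cases "\<kappa> t = i0") (auto simp: I_def)
qed

text \<open>If all weights vanished, the triangle inequality over the cells would give norm zero.
  The index found is the one whose dual weight gets raised later.\<close>

lemma exists_weight_pos:
  fixes H :: "'i \<Rightarrow> 'x::real_normed_vector"
  assumes "H i0 = 0" "KN (\<lambda>t. H (\<kappa> t)) > 0"
  shows "\<exists>j\<in>I. weight j > 0"
proof (rule ccontr)
  interpret function_seminorm "KB :: ('s \<Rightarrow> 'x) set" KN by (rule function_seminorm_KB)
  assume *: "\<not> (\<exists>j\<in>I. weight j > 0)"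
  have "KN (\<lambda>t. H (\<kappa> t)) \<le> (\<Sum>i\<in>I. KN (cell i (H i)))"
    unfolding comp_eq_sum_cell[of H, OF assms(1)] by (intro N_sum cell_KB)
  also have "\<dots> \<le> 0" using * by (intro sum_nonpos) (simp add: KN_cell not_less mult_nonneg_nonpos)
  finally show False using assms(2) by simp
qed

text \<open>Nearly norming vectors \<open>u i\<close> on all cells, combined with the weights
  \<open>c i\<close>, give one test function on which \<open>\<phi>\<close> is almost the sum and
  whose norm is at most that of \<open>c\<close>.\<close>

lemma functional_cells:
  fixes \<phi> :: "('s \<Rightarrow> 'x::real_normed_vector) \<Rightarrow> real"
  assumes lin: "linear_on_fun KB \<phi>" and bound: "\<And>f. f \<in> KB \<Longrightarrow> \<bar>\<phi> f\<bar> \<le> KN f"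
  shows "\<exists>a. (\<forall>i\<in>I. 0 \<le> a i \<and> (\<forall>x. \<bar>\<phi> (cell i x)\<bar> \<le> a i * norm x)) \<and>
    (\<forall>c. (\<forall>i. 0 \<le> c i) \<and> c i0 = 0 \<longrightarrow> (\<Sum>i\<in>I. a i * c i) \<le> NE (\<lambda>t. c (\<kappa> t)))"
proof -
  interpret function_seminorm "KB :: ('s \<Rightarrow> 'x) set" KN by (rule function_seminorm_KB)
  have scale: "\<phi> (cell i (r *\<^sub>R x)) = r * \<phi> (cell i x)" if "i \<in> I" for i x r
  proof -
    have "cell i (r *\<^sub>R x) = (\<lambda>t. r *\<^sub>R cell i x t)" by (auto simp: cell_def fun_eq_iff)
    then show ?thesis using linear_on_fun_scale[OF lin cell_KB[OF that]] by simp
  qed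
  define B where "B = {x::'x. norm x \<le> 1}"
  \<comment> \<open>Since the ball is symmetric, this supremum also bounds
    \<open>\<bar>\<phi>\<bar>\<close>; it is the norm of \<open>\<phi>\<close> as a functional of
    \<open>x\<close>.\<close>
  define a where "a i = (SUP x\<in>B. \<phi> (cell i x))" for i
  have bdd: "bdd_above ((\<lambda>x. \<phi> (cell i x)) ` B)" if "i \<in> I" for i
  proof (rule bdd_aboveI2)
    fix x assume x: "x \<in> B"
    have "0 \<le> weight i" using weight_nonneg[OF that] .
    then have "norm x * weight i \<le> weight i" using x by (simp add: B_def mult_left_le_one_le)
    then show "\<phi> (cell i x) \<le> weight i"
      using bound[OF cell_KB[OF that, of x]] KN_cell[OF that, of x] by simp
  qed
  have le_a: "\<phi> (cell i x) \<le> a i" if "i \<in> I" "x \<in> B" for i x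
    unfolding a_def using bdd that by (intro cSUP_upper) auto
  have "0 \<in> B" by (simp add: B_def)
  have a0: "0 \<le> a i" if "i \<in> I" for i
    using le_a[OF that \<open>0 \<in> B\<close>] scale[OF that, of 0 0] by simp
  have a_norm: "\<bar>\<phi> (cell i x)\<bar> \<le> a i * norm x" if "i \<in> I" for i x
  proof (cases "x = 0")
    case True then show ?thesis using scale[OF that, of 0 0] by simp
  next
    case False
    have "r * \<phi> (cell i x) \<le> a i" if "r = 1 / norm x \<or> r = - (1 / norm x)" for r
      using le_a[OF \<open>i \<in> I\<close>, of "r *\<^sub>R x"] scale[OF \<open>i \<in> I\<close>, of r x] that False by (auto simp: B_def)
    from this[of "1 / norm x"] this[of "- (1 / norm x)"] show ?thesis
      using False by (simp add: abs_le_iff field_simps)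
  qed
  have "(\<Sum>i\<in>I. a i * c i) \<le> NE (\<lambda>t. c (\<kappa> t))" if c: "\<And>i. 0 \<le> c i" "c i0 = 0" for c
  proof (rule field_le_epsilon)
    fix e :: real assume "e > 0"
    define S where "S = (\<Sum>i\<in>I. c i)"
    have "S \<ge> 0" using c by (simp add: S_def sum_nonneg)
    \<comment> \<open>Each cell loses \<open>e'\<close> in proportion to \<open>c i\<close>, so the
      total loss is \<open>e' * S\<close>; the \<open>1\<close> covers \<open>S = 0\<close>.\<close>
    define e' where "e' = e / (S + 1)"
    have "e' > 0" using \<open>e > 0\<close> \<open>S \<ge> 0\<close> by (simp add: e'_def)
    have "\<exists>u\<in>B. a i - e' < \<phi> (cell i u)" if "i \<in> I" for i
      using less_cSUP_iff[OF _ bdd[OF that], of "a i - e'"] \<open>0 \<in> B\<close> \<open>e' > 0\<close> unfolding a_def by auto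
    then obtain u where u: "\<And>i. i \<in> I \<Longrightarrow> u i \<in> B" "\<And>i. i \<in> I \<Longrightarrow> a i - e' < \<phi> (cell i (u i))"
      by metis
    define H where "H i = c i *\<^sub>R u i" for i
    have H0: "H i0 = 0" using c by (simp add: H_def)
    have "(\<Sum>i\<in>I. a i * c i) - e' * S = (\<Sum>i\<in>I. c i * (a i - e'))"
      by (simp add: S_def sum_distrib_left sum_subtractf algebra_simps)
    also have "\<dots> \<le> (\<Sum>i\<in>I. c i * \<phi> (cell i (u i)))"
      using u(2) c by (intro sum_mono mult_left_mono) (auto intro: less_imp_le)
    also have "\<dots> = (\<Sum>i\<in>I. \<phi> (cell i (H i)))" by (simp add: H_def scale)
    also have "\<dots> = \<phi> (\<lambda>t. H (\<kappa> t))"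
      unfolding comp_eq_sum_cell[of H, OF H0] by (rule linear_on_fun_sum[OF lin cell_KB, symmetric])
    also have "\<dots> \<le> KN (\<lambda>t. H (\<kappa> t))" using bound[OF comp_KB[of H, OF H0]] by simp
    also have "\<dots> \<le> NE (\<lambda>t. c (\<kappa> t))"
      unfolding kothe_bochner_norm_def
      using u(1) c by (intro NE_comp_mono) (auto simp: H_def B_def mult_left_le)
    finally have "(\<Sum>i\<in>I. a i * c i) \<le> NE (\<lambda>t. c (\<kappa> t)) + e' * S" by simp
    moreover have "e' * S \<le> e" using \<open>S \<ge> 0\<close> \<open>e > 0\<close> by (simp add: e'_def field_simps)
    ultimately show "(\<Sum>i\<in>I. a i * c i) \<le> NE (\<lambda>t. c (\<kappa> t)) + e" by linarith
  qed
  then show ?thesis using a0 a_norm by (intro exI[of _ a]) blast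
qed

text \<open>Choosing \<open>y i\<close> for the normalised restriction of \<open>\<phi>\<close> to
  cell \<open>i\<close> bounds the norm pointwise from below by weights \<open>c\<close>, and
  pairing \<open>c\<close> with \<open>a'\<close> recovers both \<open>\<bar>\<phi>\<bar>\<close>
  and almost \<open>1\<close>. The loss \<open>\<epsilon>\<close> inside the bracket arises because
  \<open>b\<close> is only nearly norming.\<close>

lemma WOH_cells:
  fixes \<phi> :: "('s \<Rightarrow> 'x::real_normed_vector) \<Rightarrow> real"
  assumes WOH: "WOH TYPE('x)"
    and lin: "linear_on_fun KB \<phi>" and bound: "\<And>f. f \<in> KB \<Longrightarrow> \<bar>\<phi> f\<bar> \<le> KN f"
    and F: "\<And>i. finite (F i)" and \<epsilon>: "0 < \<epsilon>" "\<epsilon> < 1" and j: "j \<in> I" "weight j > 0"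
  shows "\<exists>g\<in>KB. KN g = 1 \<and> (\<forall>H. H i0 = 0 \<longrightarrow> (\<forall>i. H i \<in> span (F i)) \<longrightarrow>
    (1 - \<epsilon>) * (\<bar>\<phi> (\<lambda>t. H (\<kappa> t))\<bar> + 1 - \<epsilon>) \<le> KN (\<lambda>t. H (\<kappa> t) + g t))"
proof -
  interpret function_seminorm "KB :: ('s \<Rightarrow> 'x) set" KN by (rule function_seminorm_KB)
  obtain a where a: "\<And>i. i \<in> I \<Longrightarrow> 0 \<le> a i" "\<And>i x. i \<in> I \<Longrightarrow> \<bar>\<phi> (cell i x)\<bar> \<le> a i * norm x"
    "\<And>c. (\<forall>i. 0 \<le> c i) \<and> c i0 = 0 \<Longrightarrow> (\<Sum>i\<in>I. a i * c i) \<le> NE (\<lambda>t. c (\<kappa> t))"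
    using functional_cells[OF lin bound] by blast
  define C where "C = {c :: 'i \<Rightarrow> real. (\<forall>i. 0 \<le> c i) \<and> c i0 = 0}"
  define \<nu> where "\<nu> c = NE (\<lambda>t. c (\<kappa> t))" for c :: "'i \<Rightarrow> real"
  have "j \<noteq> i0" using j by (simp add: I_def)
  have "\<exists>a' b. (\<forall>i. a i \<le> a' i) \<and> (\<forall>c\<in>C. (\<Sum>i\<in>I. a' i * c i) \<le> \<nu> c) \<and>
      b \<in> C \<and> \<nu> b = 1 \<and> 1 - \<epsilon> \<le> (\<Sum>i\<in>I. a' i * b i)"
  \<comment> \<open>A vector of the cone dominates its part on cell \<open>j\<close>, whence the
    constant \<open>weight j\<close>; the test vector \<open>e\<close> is the indicator of that
    cell.\<close>
  proof (rule enlarge_to_norming_weights[where j = j and m = "weight j" and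
        e = "\<lambda>i. if i = j then 1 else 0"])
    show "(\<lambda>i. if i = j then 1 else 0) \<in> C" using \<open>j \<noteq> i0\<close> by (simp add: C_def)
    show "weight j * c j \<le> \<nu> c" if "c \<in> C" for c
    proof -
      have "weight j * c j = NE (\<lambda>t. norm (cell j (c j) t))"
        using KN_cell[OF j(1), of "c j"] that by (simp add: kothe_bochner_norm_def C_def)
      also have "\<dots> = NE (\<lambda>t. (\<lambda>i. if i = j then c j else 0) (\<kappa> t))"
        using that by (intro arg_cong[where f = NE]) (auto simp: cell_def C_def)
      also have "\<dots> \<le> \<nu> c" unfolding \<nu>_def
        using that \<open>j \<noteq> i0\<close> by (intro NE_comp_mono) (auto simp: C_def)
      finally show ?thesis .
    qed
    show "(\<lambda>i. r * c i) \<in> C \<and> \<nu> (\<lambda>i. r * c i) = r * \<nu> c" if "c \<in> C" "0 \<le> r" for c r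
      using that NE_scale[OF comp_E, of c r] by (simp add: C_def \<nu>_def)
    show "(\<Sum>i\<in>I. a i * c i) \<le> \<nu> c" if "c \<in> C" for c using that a(3) by (simp add: C_def \<nu>_def)
  qed (use j \<epsilon> finite_I in \<open>auto simp: C_def\<close>)
  then obtain a' b where a': "\<And>i. a i \<le> a' i" "\<And>c. c \<in> C \<Longrightarrow> (\<Sum>i\<in>I. a' i * c i) \<le> \<nu> c"
    and b: "b \<in> C" "\<nu> b = 1" "1 - \<epsilon> \<le> (\<Sum>i\<in>I. a' i * b i)"
    by blast
  have b0: "0 \<le> b i" "b i0 = 0" for i using b(1) by (auto simp: C_def)
  have a'0: "0 \<le> a' i" if "i \<in> I" for i using a(1)[OF that] a'(1)[of i] by linarith
  \<comment> \<open>If \<open>a' i = 0\<close>, division yields \<open>0\<close>, which is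
    consistent: \<open>\<phi>\<close> then vanishes on the cell by \<open>\<phi>_le\<close>.\<close>
  define \<psi> where "\<psi> i x = \<phi> (cell i x) / a' i" for i x
  have \<phi>_le: "\<bar>\<phi> (cell i x)\<bar> \<le> a' i * norm x" if "i \<in> I" for i x
    using a(2)[OF that, of x] mult_right_mono[OF a'(1)[of i] norm_ge_zero[of x]] by linarith
  have \<psi>_le: "\<bar>\<psi> i x\<bar> \<le> norm x" if "i \<in> I" for i x
    using \<phi>_le[OF that, of x] a'0[OF that]
    by (cases "a' i = 0") (auto simp: \<psi>_def abs_divide field_simps)
  have a'\<psi>: "a' i * \<bar>\<psi> i x\<bar> = \<bar>\<phi> (cell i x)\<bar>" if "i \<in> I" for i x
    using \<phi>_le[OF that, of x] a'0[OF that] by (cases "a' i = 0") (auto simp: \<psi>_def abs_divide)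
  have lin_\<psi>: "linear (\<psi> i)" if "i \<in> I" for i
  proof
    have "cell i (x + y) = (\<lambda>t. cell i x t + cell i y t)" for x y :: 'x
      by (auto simp: cell_def fun_eq_iff)
    then show "\<psi> i (x + y) = \<psi> i x + \<psi> i y" for x y
      using linear_on_fun_add[OF lin cell_KB[OF that] cell_KB[OF that]]
      by (simp add: \<psi>_def add_divide_distrib)
    have "cell i (r *\<^sub>R x) = (\<lambda>t. r *\<^sub>R cell i x t)" for r and x :: 'x
      by (auto simp: cell_def fun_eq_iff)
    then show "\<psi> i (r *\<^sub>R x) = r *\<^sub>R \<psi> i x" for r x
      using linear_on_fun_scale[OF lin cell_KB[OF that]] by (simp add: \<psi>_def)
  qed
  then have "\<forall>i\<in>I. \<exists>y. norm y = 1 \<and> (\<forall>x\<in>span (F i). (1 - \<epsilon>) * (\<bar>\<psi> i x\<bar> + 1) \<le> norm (x + y))"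
    using WOH F \<psi>_le \<epsilon>(1) unfolding WOH_def by blast
  then obtain y where y: "\<And>i. i \<in> I \<Longrightarrow> norm (y i) = 1"
    "\<And>i x. i \<in> I \<Longrightarrow> x \<in> span (F i) \<Longrightarrow> (1 - \<epsilon>) * (\<bar>\<psi> i x\<bar> + 1) \<le> norm (x + y i)"
    by metis
  define g where "g t = b (\<kappa> t) *\<^sub>R y (\<kappa> t)" for t
  have g: "g \<in> KB" unfolding g_def[abs_def] using b0 by (intro comp_KB[of "\<lambda>i. b i *\<^sub>R y i"]) simp
  have "norm (g t) = b (\<kappa> t)" for t
    using y(1)[of "\<kappa> t"] b0 by (cases "\<kappa> t = i0") (auto simp: g_def I_def)
  then have "KN g = 1" using b(2) by (simp add: kothe_bochner_norm_def \<nu>_def)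
  moreover have "(1 - \<epsilon>) * (\<bar>\<phi> (\<lambda>t. H (\<kappa> t))\<bar> + 1 - \<epsilon>) \<le> KN (\<lambda>t. H (\<kappa> t) + g t)"
    if H: "H i0 = 0" "\<And>i. H i \<in> span (F i)" for H
  proof -
    \<comment> \<open>Where \<open>b i\<close> is zero, \<open>g\<close> vanishes and
      \<open>\<psi>_le\<close> suffices; elsewhere the property of \<open>y i\<close> is applied to
      \<open>H i\<close> divided by \<open>b i\<close>, which stays in the span.\<close>
    have pt: "(1 - \<epsilon>) * (\<bar>\<psi> i (H i)\<bar> + b i) \<le> norm (H i + b i *\<^sub>R y i)" if "i \<in> I" for i
    proof (cases "b i = 0")
      case True
      have "(1 - \<epsilon>) * \<bar>\<psi> i (H i)\<bar> \<le> 1 * \<bar>\<psi> i (H i)\<bar>" using \<epsilon> by (intro mult_right_mono) auto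
      then show ?thesis using True \<psi>_le[OF that, of "H i"] by simp
    next
      case False
      then have "b i > 0" using b0(1)[of i] by simp
      have "\<psi> i (H i) = b i * \<psi> i ((1 / b i) *\<^sub>R H i)"
        using linear_scale[OF lin_\<psi>[OF that], of "1 / b i" "H i"] \<open>b i > 0\<close> by simp
      then have "(1 - \<epsilon>) * (\<bar>\<psi> i (H i)\<bar> + b i) = b i * ((1 - \<epsilon>) * (\<bar>\<psi> i ((1 / b i) *\<^sub>R H i)\<bar> + 1))"
        using \<open>b i > 0\<close> by (simp add: abs_mult algebra_simps)
      also have "\<dots> \<le> b i * norm ((1 / b i) *\<^sub>R H i + y i)"
        using \<open>b i > 0\<close> by (intro mult_left_mono y(2) that span_scale H) auto
      also have "\<dots> = norm (b i *\<^sub>R ((1 / b i) *\<^sub>R H i + y i))" using \<open>b i > 0\<close> by simp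
      also have "\<dots> = norm (H i + b i *\<^sub>R y i)" using \<open>b i > 0\<close> unfolding scaleR_add_right by simp
      finally show ?thesis .
    qed
    \<comment> \<open>A pointwise lower bound of the norm that lies in the cone, so that
      \<open>a'\<close> can be paired with it.\<close>
    define c where "c i = (if i \<in> I then (1 - \<epsilon>) * (\<bar>\<psi> i (H i)\<bar> + b i) else 0)" for i
    have c: "c \<in> C" using \<epsilon> b0 by (auto simp: C_def c_def I_def)
    have "\<bar>\<phi> (\<lambda>t. H (\<kappa> t))\<bar> \<le> (\<Sum>i\<in>I. \<bar>\<phi> (cell i (H i))\<bar>)"
      unfolding comp_eq_sum_cell[of H, OF H(1)]
      using linear_on_fun_sum[OF lin cell_KB, of I id H] by simp
    then have "\<bar>\<phi> (\<lambda>t. H (\<kappa> t))\<bar> + 1 - \<epsilon> \<le> (\<Sum>i\<in>I. a' i * \<bar>\<psi> i (H i)\<bar>) + (\<Sum>i\<in>I. a' i * b i)"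
      using b(3) by (simp add: a'\<psi>)
    also have "\<dots> = (\<Sum>i\<in>I. a' i * (\<bar>\<psi> i (H i)\<bar> + b i))"
      by (simp add: distrib_left sum.distrib)
    finally have "(1 - \<epsilon>) * (\<bar>\<phi> (\<lambda>t. H (\<kappa> t))\<bar> + 1 - \<epsilon>)
        \<le> (1 - \<epsilon>) * (\<Sum>i\<in>I. a' i * (\<bar>\<psi> i (H i)\<bar> + b i))"
      using \<epsilon> by (intro mult_left_mono) auto
    also have "\<dots> = (\<Sum>i\<in>I. a' i * c i)"
      by (simp add: sum_distrib_left c_def algebra_simps)
    also have "\<dots> \<le> \<nu> c" using a'(2)[OF c] .
    also have "\<dots> \<le> NE (\<lambda>t. norm (H (\<kappa> t) + b (\<kappa> t) *\<^sub>R y (\<kappa> t)))"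
      unfolding \<nu>_def
    proof (rule NE_comp_mono[of _ "\<lambda>i. norm (H i + b i *\<^sub>R y i)"])
      show "\<bar>c i\<bar> \<le> \<bar>norm (H i + b i *\<^sub>R y i)\<bar>" if "i \<in> I" for i
        using pt[OF that] c that by (simp add: C_def) (simp add: c_def)
    qed (use H b0 c in \<open>auto simp: C_def\<close>)
    finally show ?thesis by (simp add: kothe_bochner_norm_def g_def)
  qed
  ultimately show ?thesis using g by blast
qed

end

section \<open>From finitely many cells to arbitrary finite-dimensional subspaces\<close>

lemma fspan_insert: "finite A \<Longrightarrow> h \<in> fspan A \<Longrightarrow> h \<in> fspan (insert b A)"
proof -
  assume A: "finite A" "h \<in> fspan A"
  show ?thesis
  proof (cases "b \<in> A")
    case False
    from A obtain c where c: "\<And>t. h t = (\<Sum>a\<in>A. c a *\<^sub>R a t)" unfolding fspan_def by auto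
    have "(\<Sum>a\<in>A. (c(b := 0)) a *\<^sub>R a t) = (\<Sum>a\<in>A. c a *\<^sub>R a t)" for t
      using False by (intro sum.cong) auto
    then have "\<forall>t. h t = (\<Sum>a\<in>insert b A. (c(b := 0)) a *\<^sub>R a t)"
      using A(1) False by (simp add: c)
    then show ?thesis unfolding fspan_def mem_Collect_eq by (intro exI)
  qed (use A in \<open>simp add: insert_absorb\<close>)
qed

context koethe_lattice
begin

text \<open>Labelling a point by the whole tuple of its values makes every member of the family a
  function of the label. Extending tuples by zero off \<open>A\<close> leaves finitely many labels,
  and the zero tuple is the exceptional one.\<close>

lemma finite_cells_simple_family:
  fixes s :: "'a \<Rightarrow> 's \<Rightarrow> 'x::real_normed_vector"
  assumes A: "finite A" "A \<noteq> {}"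
    and s: "\<And>a. a \<in> A \<Longrightarrow> Bochner_Integration.simple_bochner_integrable M (s a)"
    and out: "\<And>a t. a \<in> A \<Longrightarrow> t \<notin> space M \<Longrightarrow> s a t = 0"
  shows "finite_cells M E NE (\<lambda>t a. if a \<in> A then s a t else 0) (\<lambda>_. 0)"
proof -
  define \<kappa> where "\<kappa> t a = (if a \<in> A then s a t else 0)" for t a
  have sf: "simple_function M (s a)" and sfin: "emeasure M {x \<in> space M. s a x \<noteq> 0} \<noteq> \<infinity>" if "a \<in> A" for a
    using s[OF that] by (auto elim: simple_bochner_integrable.cases)
  have space: "t \<in> space M" if "\<kappa> t = i" "i \<noteq> (\<lambda>_. 0)" for t i
  proof (rule ccontr)
    assume "t \<notin> space M"
    then have "\<kappa> t = (\<lambda>_. 0)" using out by (auto simp: \<kappa>_def)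
    then show False using that by simp
  qed
  define B where "B = insert 0 (\<Union>a\<in>A. s a ` space M)"
  have "finite B" using A sf by (auto simp: B_def simple_function_def)
  then have "finite {f. \<forall>a. (a \<in> A \<longrightarrow> f a \<in> B) \<and> (a \<notin> A \<longrightarrow> f a = 0)}"
    using A by (intro finite_set_of_finite_funs)
  moreover have "range \<kappa> \<subseteq> {f. \<forall>a. (a \<in> A \<longrightarrow> f a \<in> B) \<and> (a \<notin> A \<longrightarrow> f a = 0)}"
  proof -
    have "s a t \<in> B" if "a \<in> A" for a t
      using that out[OF that, of t] by (cases "t \<in> space M") (auto simp: B_def)
    then show ?thesis by (auto simp: \<kappa>_def)
  qed
  ultimately have fin: "finite (range \<kappa>)" by (rule finite_subset[rotated])
  have sets: "\<kappa> -` {i} \<in> sets M" if "i \<noteq> (\<lambda>_. 0)" for i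
  proof (cases "\<forall>a. a \<notin> A \<longrightarrow> i a = 0")
    case True
    have "\<kappa> -` {i} = (\<Inter>a\<in>A. s a -` {i a} \<inter> space M)"
    proof (intro equalityI subsetI)
      fix t assume "t \<in> \<kappa> -` {i}"
      then show "t \<in> (\<Inter>a\<in>A. s a -` {i a} \<inter> space M)"
        using space[of t i] that by (auto simp: \<kappa>_def)
    next
      fix t assume "t \<in> (\<Inter>a\<in>A. s a -` {i a} \<inter> space M)"
      then show "t \<in> \<kappa> -` {i}" using True A by (auto simp: \<kappa>_def fun_eq_iff)
    qed
    also have "\<dots> \<in> sets M" using A sf by (intro sets.finite_INT) (auto intro: simple_functionD)
    finally show ?thesis .
  next
    case False
    then have "\<kappa> -` {i} = {}" by (auto simp: \<kappa>_def fun_eq_iff)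
    then show ?thesis by simp
  qed
  \<comment> \<open>A nonempty cell with nonzero label lies in the support of some
    \<open>s a\<close>.\<close>
  have finm: "emeasure M (\<kappa> -` {i}) < \<infinity>" if i: "i \<noteq> (\<lambda>_. 0)" for i
  proof (cases "\<exists>a\<in>A. i a \<noteq> 0")
    case True
    then obtain a where a: "a \<in> A" "i a \<noteq> 0" by blast
    have "{x \<in> space M. s a x \<noteq> 0} = space M - s a -` {0} \<inter> space M" by auto
    also have "\<dots> \<in> sets M" using simple_functionD(2)[OF sf[OF a(1)]] by auto
    finally have "emeasure M (\<kappa> -` {i}) \<le> emeasure M {x \<in> space M. s a x \<noteq> 0}"
      using a space[of _ i] i by (intro emeasure_mono) (auto simp: \<kappa>_def)
    also have "\<dots> < \<infinity>" using sfin[OF a(1)] by (simp add: less_top)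
    finally show ?thesis .
  next
    case False
    then have "\<kappa> -` {i} = {}" using i by (auto simp: \<kappa>_def fun_eq_iff)
    then show ?thesis by simp
  qed
  have "finite_cells M E NE \<kappa> (\<lambda>_. 0)"
    by unfold_locales (use fin sets finm in auto)
  then show ?thesis unfolding \<kappa>_def[abs_def] .
qed

text \<open>A combination of the \<open>s a\<close> is a function \<open>H\<close> of the label,
  where \<open>H i\<close> is the same combination of the coordinates of \<open>i\<close>, hence in
  their span. The member \<open>s d\<close> of positive norm guarantees a cell of positive
  weight.\<close>

lemma WOH_simple_family:
  fixes \<phi> :: "('s \<Rightarrow> 'x::real_normed_vector) \<Rightarrow> real" and s :: "'a \<Rightarrow> 's \<Rightarrow> 'x"
  assumes WOH: "WOH TYPE('x)"
    and lin: "linear_on_fun KB \<phi>" and bound: "\<And>f. f \<in> KB \<Longrightarrow> \<bar>\<phi> f\<bar> \<le> KN f"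
    and \<epsilon>: "0 < \<epsilon>" "\<epsilon> < 1" and A: "finite A" "d \<in> A" "KN (s d) > 0"
    and s: "\<And>a. a \<in> A \<Longrightarrow> Bochner_Integration.simple_bochner_integrable M (s a)"
    and out: "\<And>a t. a \<in> A \<Longrightarrow> t \<notin> space M \<Longrightarrow> s a t = 0"
  shows "\<exists>g\<in>KB. KN g = 1 \<and> (\<forall>c. (1 - \<epsilon>) * (\<bar>\<phi> (\<lambda>t. \<Sum>a\<in>A. c a *\<^sub>R s a t)\<bar> + 1 - \<epsilon>)
           \<le> KN (\<lambda>t. (\<Sum>a\<in>A. c a *\<^sub>R s a t) + g t))"
proof -
  define \<kappa> where "\<kappa> t a = (if a \<in> A then s a t else 0)" for t a
  interpret finite_cells M E NE \<kappa> "\<lambda>_. 0"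
    unfolding \<kappa>_def[abs_def] using A s out by (intro finite_cells_simple_family) auto
  obtain j where j: "j \<in> I" "weight j > 0"
    using exists_weight_pos[of "\<lambda>i. i d"] A by (auto simp: \<kappa>_def)
  have "\<exists>g\<in>KB. KN g = 1 \<and> (\<forall>H. H (\<lambda>_. 0) = 0 \<longrightarrow> (\<forall>i. H i \<in> span (i ` A)) \<longrightarrow>
    (1 - \<epsilon>) * (\<bar>\<phi> (\<lambda>t. H (\<kappa> t))\<bar> + 1 - \<epsilon>) \<le> KN (\<lambda>t. H (\<kappa> t) + g t))"
    using A by (intro WOH_cells[OF WOH lin bound _ \<epsilon> j]) auto
  then obtain g where g: "g \<in> KB" "KN g = 1" and gH: "\<And>H. H (\<lambda>_. 0) = 0 \<Longrightarrow>
      (\<And>i. H i \<in> span (i ` A)) \<Longrightarrow>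
      (1 - \<epsilon>) * (\<bar>\<phi> (\<lambda>t. H (\<kappa> t))\<bar> + 1 - \<epsilon>) \<le> KN (\<lambda>t. H (\<kappa> t) + g t)"
    by blast
  have "(1 - \<epsilon>) * (\<bar>\<phi> (\<lambda>t. \<Sum>a\<in>A. c a *\<^sub>R s a t)\<bar> + 1 - \<epsilon>)
           \<le> KN (\<lambda>t. (\<Sum>a\<in>A. c a *\<^sub>R s a t) + g t)" for c
  proof -
    have "(\<Sum>a\<in>A. c a *\<^sub>R i a) \<in> span (i ` A)" for i :: "'a \<Rightarrow> 'x"
      by (intro span_sum span_scale span_base) auto
    then show ?thesis using gH[of "\<lambda>i. \<Sum>a\<in>A. c a *\<^sub>R i a"] by (simp add: \<kappa>_def)
  qed
  then show ?thesis using g by blast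
qed

text \<open>Simplicity constrains values on \<open>space M\<close> only, whereas cells partition the
  whole type; cutting off outside the space leaves the norm unchanged.\<close>

lemma simple_dense_supported:
  fixes f :: "'s \<Rightarrow> 'x::real_normed_vector"
  assumes "simple_dense M E NE TYPE('x)" "f \<in> KB" "0 < e"
  shows "\<exists>u. Bochner_Integration.simple_bochner_integrable M u \<and> (\<forall>t. t \<notin> space M \<longrightarrow> u t = 0)
           \<and> KN (\<lambda>t. f t - u t) < e"
proof -
  interpret function_seminorm "KB :: ('s \<Rightarrow> 'x) set" KN by (rule function_seminorm_KB)
  obtain v where v: "Bochner_Integration.simple_bochner_integrable M v" "KN (\<lambda>t. f t - v t) < e"
    using assms unfolding simple_dense_def by blast
  define u where "u t = (if t \<in> space M then v t else 0)" for t
  have "Bochner_Integration.simple_bochner_integrable M u"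
  proof
    have "simple_function M v" using v(1) by (auto elim: simple_bochner_integrable.cases)
    then show "simple_function M u" by (rule simple_function_cong[THEN iffD1, rotated]) (simp add: u_def)
    have "{y \<in> space M. u y \<noteq> 0} = {y \<in> space M. v y \<noteq> 0}" by (auto simp: u_def)
    then show "emeasure M {y \<in> space M. u y \<noteq> 0} \<noteq> \<infinity>"
      using v(1) by (auto elim: simple_bochner_integrable.cases)
  qed
  moreover from this have "KN (\<lambda>t. f t - u t) = KN (\<lambda>t. f t - v t)"
    using v(1) by (intro KN_AE_cong diff_mem assms(2) AE_I2) (auto simp: u_def[abs_def] intro: simple_mem_KB)
  ultimately show ?thesis using v(2) by (intro exI[of _ u]) (auto simp: u_def)
qed

text \<open>The function \<open>g\<close> must be found before \<open>h\<close> is known: it comes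
  from simple approximations of the generators, accurate for all \<open>h\<close> of norm below
  \<open>2 / \<delta>\<close>. For larger \<open>h\<close> any unit vector satisfies the bound,
  because \<open>\<bar>\<phi> h\<bar> \<le> KN h\<close>.\<close>

lemma WOH_kothe_bochner:
  assumes WOH: "WOH TYPE('x::real_normed_vector)" and dense: "simple_dense M E NE TYPE('x)"
    and "sigma_finite_measure M" "emeasure M (space M) > 0"
  shows "WOH_fun (KB :: ('s \<Rightarrow> 'x) set) KN"
  unfolding WOH_fun_def
proof (intro allI impI, elim conjE)
  fix A :: "('s \<Rightarrow> 'x) set" and \<phi> :: "('s \<Rightarrow> 'x) \<Rightarrow> real" and \<epsilon> :: real
  assume A: "finite A" "A \<subseteq> KB" and lin: "linear_on_fun KB \<phi>"
    and bound: "\<forall>f\<in>KB. \<bar>\<phi> f\<bar> \<le> KN f" and "\<epsilon> > 0"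
  interpret function_seminorm "KB :: ('s \<Rightarrow> 'x) set" KN by (rule function_seminorm_KB)
  obtain y :: 'x where "norm y = 1"
  proof -
    \<comment> \<open>Trivial data suffice to extract a unit vector from weak octahedrality.\<close>
    have "finite {}" "linear (\<lambda>_::'x. 0::real)" "\<forall>x::'x. \<bar>0::real\<bar> \<le> norm x" "(1::real) > 0"
      by (auto intro: linearI)
    then show ?thesis using WOH that unfolding WOH_def by blast
  qed
  then obtain d :: "'s \<Rightarrow> 'x" where d: "d \<in> KB" "KN d > 0"
    using exists_KN_pos[OF assms(3,4)] by blast
  \<comment> \<open>Adding \<open>d\<close> ensures a generator whose approximation has positive
    norm, even when all elements of \<open>A\<close> have norm zero.\<close>
  define A' where "A' = insert d A"
  have A': "finite A'" "A' \<subseteq> KB" "d \<in> A'" using A d by (auto simp: A'_def)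
  obtain C where "C \<ge> 0" and C: "\<And>h \<eta>. h \<in> fspan A' \<Longrightarrow> \<eta> > 0 \<Longrightarrow>
      \<exists>c. KN (\<lambda>t. h t - (\<Sum>a\<in>A'. c a *\<^sub>R a t)) \<le> \<eta> \<and> (\<Sum>a\<in>A'. \<bar>c a\<bar>) \<le> C * (KN h + \<eta>)"
    using approximate_coefficients[OF A'(1,2)] by blast
  \<comment> \<open>Of the four losses, two are those of \<open>WOH_simple_family\<close>, as a
    factor and inside the bracket; two come from replacing \<open>h\<close> by a simple
    \<open>l\<close>, in \<open>\<phi>\<close> and in the norm.\<close>
  define \<delta> where "\<delta> = min \<epsilon> 1 / 4"
  have \<delta>: "0 < \<delta>" "\<delta> < 1" "4 * \<delta> \<le> \<epsilon>" using \<open>\<epsilon> > 0\<close> by (auto simp: \<delta>_def)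
  \<comment> \<open>Bound for the coefficient sum of any \<open>h\<close> of norm below
    \<open>2 / \<delta>\<close> when approximated up to \<open>\<delta> / 2\<close>.\<close>
  define K where "K = C * (2 / \<delta> + \<delta> / 2)"
  have "K \<ge> 0" using \<open>C \<ge> 0\<close> \<delta> by (simp add: K_def)
  \<comment> \<open>The first term keeps the change of a combination with coefficient sum at most
    \<open>K\<close> within \<open>\<delta> / 2\<close>; the second keeps the norm of
    \<open>s d\<close> positive.\<close>
  define \<rho> where "\<rho> = min (\<delta> / (2 * (K + 1))) (KN d / 2)"
  have "\<rho> > 0" using \<delta> \<open>K \<ge> 0\<close> d by (simp add: \<rho>_def)
  have "\<rho> * K \<le> \<delta> / (2 * (K + 1)) * K" using \<open>K \<ge> 0\<close> by (intro mult_right_mono) (auto simp: \<rho>_def)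
  also have "\<dots> \<le> \<delta> / 2" using \<open>K \<ge> 0\<close> \<delta> by (simp add: field_simps)
  finally have \<rho>K: "\<rho> * K \<le> \<delta> / 2" .
  have "\<forall>a\<in>A'. \<exists>u. Bochner_Integration.simple_bochner_integrable M u \<and> (\<forall>t. t \<notin> space M \<longrightarrow> u t = 0)
           \<and> KN (\<lambda>t. a t - u t) < \<rho>"
    using simple_dense_supported[OF dense _ \<open>\<rho> > 0\<close>] A'(2) by blast
  then obtain s where s: "\<And>a. a \<in> A' \<Longrightarrow> Bochner_Integration.simple_bochner_integrable M (s a)"
    "\<And>a t. a \<in> A' \<Longrightarrow> t \<notin> space M \<Longrightarrow> s a t = 0"
    "\<And>a. a \<in> A' \<Longrightarrow> KN (\<lambda>t. a t - s a t) < \<rho>"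
    by metis
  have sKB: "s a \<in> KB" if "a \<in> A'" for a using simple_mem_KB[OF s(1)[OF that]] .
  have aKB: "a \<in> KB" if "a \<in> A'" for a using that A'(2) by blast
  have "KN d \<le> KN (s d) + KN (\<lambda>t. d t - s d t)" using N_le_add_diff[OF d(1) sKB[OF A'(3)]] .
  then have "KN (s d) > 0" using s(3)[OF A'(3)] d(2) by (simp add: \<rho>_def)
  then have "\<exists>g\<in>KB. KN g = 1 \<and> (\<forall>c. (1 - \<delta>) * (\<bar>\<phi> (\<lambda>t. \<Sum>a\<in>A'. c a *\<^sub>R s a t)\<bar> + 1 - \<delta>)
           \<le> KN (\<lambda>t. (\<Sum>a\<in>A'. c a *\<^sub>R s a t) + g t))"
    using bound s(1,2) by (intro WOH_simple_family[OF WOH lin _ \<delta>(1,2) A'(1,3)]) auto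
  then obtain g where g: "g \<in> KB" "KN g = 1"
    and gc: "\<And>c. (1 - \<delta>) * (\<bar>\<phi> (\<lambda>t. \<Sum>a\<in>A'. c a *\<^sub>R s a t)\<bar> + 1 - \<delta>)
           \<le> KN (\<lambda>t. (\<Sum>a\<in>A'. c a *\<^sub>R s a t) + g t)"
    by blast
  have "(1 - \<epsilon>) * (\<bar>\<phi> h\<bar> + 1) \<le> KN (\<lambda>t. h t + g t)" if "h \<in> fspan A" for h
  proof -
    have hA: "h \<in> fspan A'" unfolding A'_def using fspan_insert[OF A(1) that] .
    then have h: "h \<in> KB" using fspan_subset[OF A'(2)] by blast
    have hg: "(\<lambda>t. h t + g t) \<in> KB" using add_mem[OF h g(1)] .
    have "(1 - 4 * \<delta>) * (\<bar>\<phi> h\<bar> + 1) \<le> KN (\<lambda>t. h t + g t)"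
    proof (cases "KN h \<ge> 2 / \<delta>")
      \<comment> \<open>Here \<open>KN h - 1\<close> is at least
        \<open>(1 - \<delta>) * (KN h + 1)\<close>, so the triangle inequality alone
        decides.\<close>
      case True
      then have "2 \<le> \<delta> * KN h" using \<delta>(1) by (simp add: field_simps)
      then have "(1 - \<delta>) * (KN h + 1) \<le> KN h - 1" using \<delta>(1) by (simp add: algebra_simps)
      moreover have "KN h - 1 \<le> KN (\<lambda>t. h t + g t)" using N_diff[OF hg g(1)] g(2) by simp
      moreover have "(1 - 4 * \<delta>) * (\<bar>\<phi> h\<bar> + 1) \<le> (1 - \<delta>) * (\<bar>\<phi> h\<bar> + 1)"
        using \<delta>(1) by (intro mult_right_mono) auto
      moreover have "(1 - \<delta>) * (\<bar>\<phi> h\<bar> + 1) \<le> (1 - \<delta>) * (KN h + 1)"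
        using \<delta>(2) bound h by (intro mult_left_mono) auto
      ultimately show ?thesis by linarith
    next
      case False
      obtain c where c: "KN (\<lambda>t. h t - (\<Sum>a\<in>A'. c a *\<^sub>R a t)) \<le> \<delta> / 2"
        "(\<Sum>a\<in>A'. \<bar>c a\<bar>) \<le> C * (KN h + \<delta> / 2)"
        using C[OF hA, of "\<delta> / 2"] \<delta>(1) by auto
      \<comment> \<open>\<open>k\<close> approximates \<open>h\<close> with controlled coefficients,
        and \<open>l\<close> replaces the generators in \<open>k\<close> by simple
        functions.\<close>
      define k where "k t = (\<Sum>a\<in>A'. c a *\<^sub>R a t)" for t
      define l where "l t = (\<Sum>a\<in>A'. c a *\<^sub>R s a t)" for t
      have k: "k \<in> KB" unfolding k_def[abs_def] by (intro sum_mem scale_mem aKB)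
      have l: "l \<in> KB" unfolding l_def[abs_def] by (intro sum_mem scale_mem sKB)
      have "C * (KN h + \<delta> / 2) \<le> K"
        unfolding K_def using False \<open>C \<ge> 0\<close> by (intro mult_left_mono) auto
      have "KN (\<lambda>t. k t - l t) = KN (\<lambda>t. \<Sum>a\<in>A'. c a *\<^sub>R (a t - s a t))"
        by (simp add: k_def l_def sum_subtractf scaleR_diff_right)
      also have "\<dots> \<le> (\<Sum>a\<in>A'. KN (\<lambda>t. c a *\<^sub>R (a t - s a t)))"
        by (intro N_sum scale_mem diff_mem aKB sKB)
      also have "\<dots> = (\<Sum>a\<in>A'. \<bar>c a\<bar> * KN (\<lambda>t. a t - s a t))"
        by (intro sum.cong refl N_scale diff_mem aKB sKB)
      also have "\<dots> \<le> (\<Sum>a\<in>A'. \<bar>c a\<bar> * \<rho>)"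
        using s(3) by (intro sum_mono mult_left_mono) (auto intro: less_imp_le)
      also have "\<dots> = \<rho> * (\<Sum>a\<in>A'. \<bar>c a\<bar>)" by (simp add: sum_distrib_left mult.commute)
      also have "\<dots> \<le> \<rho> * K"
        using c(2) \<open>C * (KN h + \<delta> / 2) \<le> K\<close> \<open>\<rho> > 0\<close> by (intro mult_left_mono) auto
      also have "\<dots> \<le> \<delta> / 2" by fact
      finally have "KN (\<lambda>t. k t - l t) \<le> \<delta> / 2" .
      then have hl: "KN (\<lambda>t. h t - l t) \<le> \<delta>"
        using N_triangle_diff[OF h k l] c(1) by (simp add: k_def)
      have "\<bar>\<phi> h - \<phi> l\<bar> \<le> \<delta>"
        using bound[rule_format, OF diff_mem[OF h l]] linear_on_fun_diff[OF lin h l] hl by simp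
      then have "(1 - \<delta>) * (\<bar>\<phi> h\<bar> + 1 - 2 * \<delta>) \<le> (1 - \<delta>) * (\<bar>\<phi> l\<bar> + 1 - \<delta>)"
        using \<delta>(2) by (intro mult_left_mono) auto
      also have "\<dots> \<le> KN (\<lambda>t. l t + g t)" using gc[of c] by (simp add: l_def[abs_def])
      also have "\<dots> \<le> KN (\<lambda>t. h t + g t) + \<delta>"
        using N_le_add_diff[OF add_mem[OF l g(1)] hg] N_minus_commute[OF h l] hl by simp
      finally have "(1 - \<delta>) * (\<bar>\<phi> h\<bar> + 1 - 2 * \<delta>) - \<delta> \<le> KN (\<lambda>t. h t + g t)" by simp
      moreover have "(1 - 4 * \<delta>) * (\<bar>\<phi> h\<bar> + 1) \<le> (1 - \<delta>) * (\<bar>\<phi> h\<bar> + 1 - 2 * \<delta>) - \<delta>"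
      proof -
        have "0 \<le> \<delta> * \<delta>" "0 \<le> \<delta> * \<bar>\<phi> h\<bar>" using \<delta>(1) by auto
        then show ?thesis by (simp add: algebra_simps)
      qed
      ultimately show ?thesis by linarith
    qed
    moreover have "(1 - \<epsilon>) * (\<bar>\<phi> h\<bar> + 1) \<le> (1 - 4 * \<delta>) * (\<bar>\<phi> h\<bar> + 1)"
      using \<delta>(3) by (intro mult_right_mono) auto
    ultimately show ?thesis by linarith
  qed
  then show "\<exists>g\<in>KB. KN g = 1 \<and> (\<forall>h\<in>fspan A. (1 - \<epsilon>) * (\<bar>\<phi> h\<bar> + 1) \<le> KN (\<lambda>t. h t + g t))"
    using g by blast
qed

end

section \<open>Lebesgue-Bochner spaces\<close>

text \<open>Convexity of the power function at \<open>(x + y) / (\<alpha> + \<beta>)\<close>, a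
  convex combination of \<open>x / \<alpha>\<close> and \<open>y / \<beta>\<close>. With
  \<open>\<alpha>\<close> and \<open>\<beta>\<close> close to the two norms, integration yields
  Minkowski's inequality.\<close>

lemma powr_add_le:
  fixes x y \<alpha> \<beta> p :: real
  assumes "1 \<le> p" "0 \<le> x" "0 \<le> y" "0 < \<alpha>" "0 < \<beta>"
  shows "(x + y) powr p \<le> (\<alpha> + \<beta>) powr p *
    (\<alpha> / (\<alpha> + \<beta>) * (x powr p / \<alpha> powr p) + \<beta> / (\<alpha> + \<beta>) * (y powr p / \<beta> powr p))"
proof -
  \<comment> \<open>Covers a vanishing endpoint, so that convexity is applied to positive arguments
    only.\<close>
  have zero: "(l * z) powr p \<le> l * z powr p" if "0 \<le> l" "l \<le> 1" "0 \<le> z" for l z :: real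
  proof -
    have "l powr p \<le> l powr 1" using that assms(1) by (intro powr_mono') auto
    then show ?thesis using that by (simp add: powr_mult mult_right_mono)
  qed
  have conv: "(l * u + (1 - l) * v) powr p \<le> l * u powr p + (1 - l) * v powr p"
    if "0 \<le> l" "l \<le> 1" "0 \<le> u" "0 \<le> v" for l u v :: real
  proof (cases "u = 0 \<or> v = 0")
    case True
    then show ?thesis using zero[of l u] zero[of "1 - l" v] that by auto
  next
    case False
    then show ?thesis
      using convex_onD[OF powr_convex[OF assms(1)], of "1 - l" u v] that by simp
  qed
  define l where "l = \<alpha> / (\<alpha> + \<beta>)"
  have l: "0 \<le> l" "l \<le> 1" "1 - l = \<beta> / (\<alpha> + \<beta>)" using assms by (auto simp: l_def field_simps)
  have "(\<alpha> + \<beta>) * l = \<alpha>" "(\<alpha> + \<beta>) * (1 - l) = \<beta>"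
    using assms unfolding l(3) unfolding l_def by auto
  then have "x + y = (\<alpha> + \<beta>) * (l * (x / \<alpha>) + (1 - l) * (y / \<beta>))"
    using assms by (simp only: distrib_left flip: mult.assoc) simp
  then have "(x + y) powr p = (\<alpha> + \<beta>) powr p * (l * (x / \<alpha>) + (1 - l) * (y / \<beta>)) powr p"
    using assms l by (simp add: powr_mult)
  also have "\<dots> \<le> (\<alpha> + \<beta>) powr p * (l * (x / \<alpha>) powr p + (1 - l) * (y / \<beta>) powr p)"
    using assms l by (intro mult_left_mono conv) auto
  finally show ?thesis using assms l by (simp add: powr_divide l_def)
qed

section \<open>Scalar \<open>L^p\<close> spaces and density of simple functions\<close>

context
  fixes M :: "'s measure" and p :: real
  assumes p: "1 \<le> p"
begin

text \<open>Scalar counterpart of \<open>Lp_bochner\<close>; the absolute value gives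
  \<open>powr\<close> a nonnegative base.\<close>

definition Lp :: "('s \<Rightarrow> real) set"
  where "Lp = {f \<in> borel_measurable M. integrable M (\<lambda>x. \<bar>f x\<bar> powr p)}"

definition Lp_norm :: "('s \<Rightarrow> real) \<Rightarrow> real"
  where "Lp_norm f = (\<integral>x. \<bar>f x\<bar> powr p \<partial>M) powr (1 / p)"

text \<open>Integrating \<open>powr_add_le\<close> gives Minkowski's inequality; its instance with
  \<open>\<alpha> = \<beta> = 1\<close> already gives integrability of the sum.\<close>

lemma Lp_add:
  assumes f: "f \<in> Lp" and g: "g \<in> Lp"
  shows "(\<lambda>x. f x + g x) \<in> Lp" and "Lp_norm (\<lambda>x. f x + g x) \<le> Lp_norm f + Lp_norm g"
proof -
  have [measurable]: "f \<in> borel_measurable M" "g \<in> borel_measurable M" using f g by (auto simp: Lp_def)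
  have int: "integrable M (\<lambda>x. \<bar>f x\<bar> powr p)" "integrable M (\<lambda>x. \<bar>g x\<bar> powr p)"
    using f g by (auto simp: Lp_def)
  define B where "B \<alpha> \<beta> x = (\<alpha> + \<beta>) powr p * (\<alpha> / (\<alpha> + \<beta>) * (\<bar>f x\<bar> powr p / \<alpha> powr p)
      + \<beta> / (\<alpha> + \<beta>) * (\<bar>g x\<bar> powr p / \<beta> powr p))" for \<alpha> \<beta> x
  have B: "integrable M (B \<alpha> \<beta>)" for \<alpha> \<beta> unfolding B_def[abs_def] using int by auto
  have le: "\<bar>f x + g x\<bar> powr p \<le> B \<alpha> \<beta> x" if "\<alpha> > 0" "\<beta> > 0" for \<alpha> \<beta> x
  proof -
    have "\<bar>f x + g x\<bar> powr p \<le> (\<bar>f x\<bar> + \<bar>g x\<bar>) powr p" using p by (intro powr_mono2) auto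
    also have "\<dots> \<le> B \<alpha> \<beta> x" unfolding B_def using p that by (intro powr_add_le) auto
    finally show ?thesis .
  qed
  have intsum: "integrable M (\<lambda>x. \<bar>f x + g x\<bar> powr p)"
    by (rule Bochner_Integration.integrable_bound[OF B[of 1 1]])
       (use le[of 1 1] in \<open>auto intro!: AE_I2 order_trans[OF _ abs_ge_self]\<close>)
  then show "(\<lambda>x. f x + g x) \<in> Lp" by (simp add: Lp_def)
  show "Lp_norm (\<lambda>x. f x + g x) \<le> Lp_norm f + Lp_norm g"
  proof (rule field_le_epsilon)
    fix e :: real assume "e > 0"
    \<comment> \<open>The summand \<open>e / 2\<close> makes both numbers positive even if a norm
      vanishes, as the division in \<open>B\<close> requires.\<close>
    define \<alpha> where "\<alpha> = Lp_norm f + e / 2"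
    define \<beta> where "\<beta> = Lp_norm g + e / 2"
    have pos: "\<alpha> > 0" "\<beta> > 0"
      using \<open>e > 0\<close> by (auto simp: \<alpha>_def \<beta>_def Lp_norm_def intro!: add_nonneg_pos)
    have bnd: "(\<integral>x. \<bar>h x\<bar> powr p \<partial>M) \<le> \<gamma> powr p" if "\<gamma> \<ge> Lp_norm h" for h \<gamma>
    proof -
      have "(\<integral>x. \<bar>h x\<bar> powr p \<partial>M) = Lp_norm h powr p"
        using p by (simp add: Lp_norm_def powr_powr)
      also have "\<dots> \<le> \<gamma> powr p" using that p by (intro powr_mono2) (auto simp: Lp_norm_def)
      finally show ?thesis .
    qed
    have "(\<integral>x. \<bar>f x + g x\<bar> powr p \<partial>M) \<le> (\<integral>x. B \<alpha> \<beta> x \<partial>M)"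
      using le pos by (intro integral_mono intsum B) auto
    also have "\<dots> = (\<alpha> + \<beta>) powr p * (\<alpha> / (\<alpha> + \<beta>) * ((\<integral>x. \<bar>f x\<bar> powr p \<partial>M) / \<alpha> powr p)
        + \<beta> / (\<alpha> + \<beta>) * ((\<integral>x. \<bar>g x\<bar> powr p \<partial>M) / \<beta> powr p))"
      unfolding B_def using int by simp
    also have "\<dots> \<le> (\<alpha> + \<beta>) powr p * (\<alpha> / (\<alpha> + \<beta>) * 1 + \<beta> / (\<alpha> + \<beta>) * 1)"
      using bnd[of f \<alpha>] bnd[of g \<beta>] pos \<open>e > 0\<close>
      by (intro mult_left_mono add_mono) (auto simp: \<alpha>_def \<beta>_def)
    also have "\<dots> = (\<alpha> + \<beta>) powr p" using pos by (simp flip: add_divide_distrib)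
    finally have "Lp_norm (\<lambda>x. f x + g x) \<le> ((\<alpha> + \<beta>) powr p) powr (1 / p)"
      unfolding Lp_norm_def using p by (intro powr_mono2) auto
    also have "\<dots> = \<alpha> + \<beta>" using p pos by (simp add: powr_powr)
    finally show "Lp_norm (\<lambda>x. f x + g x) \<le> Lp_norm f + Lp_norm g + e"
      by (simp add: \<alpha>_def \<beta>_def)
  qed
qed

lemma koethe_lattice_Lp:
  assumes "complete_measure M" shows "koethe_lattice M Lp Lp_norm"
proof (intro koethe_lattice.intro assms koethe_lattice_axioms.intro)
  show "f \<in> Lp \<Longrightarrow> f \<in> borel_measurable M" for f by (simp add: Lp_def)
  show "(\<lambda>x. c * f x) \<in> Lp" if "f \<in> Lp" for f c
    using that by (auto simp: Lp_def abs_mult powr_mult)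
  show "Lp_norm (\<lambda>x. c * f x) = \<bar>c\<bar> * Lp_norm f" if "f \<in> Lp" for f c
    using p by (simp add: Lp_norm_def abs_mult powr_mult powr_powr)
  show "indicator A \<in> Lp" if "A \<in> sets M" "emeasure M A < \<infinity>" for A
  proof -
    have "(\<lambda>x. \<bar>indicator A x :: real\<bar> powr p) = indicator A"
      using p by (auto simp: indicator_def fun_eq_iff)
    then show ?thesis using that by (simp add: Lp_def)
  qed
  fix f g assume f: "f \<in> Lp" and g: "g \<in> borel_measurable M" and le: "AE x in M. \<bar>g x\<bar> \<le> \<bar>f x\<bar>"
  have lep: "AE x in M. \<bar>g x\<bar> powr p \<le> \<bar>f x\<bar> powr p"
    using le by eventually_elim (use p in \<open>auto intro!: powr_mono2\<close>)
  have int: "integrable M (\<lambda>x. \<bar>g x\<bar> powr p)"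
    by (rule Bochner_Integration.integrable_bound[of _ "\<lambda>x. \<bar>f x\<bar> powr p"])
       (use f g lep in \<open>auto simp: Lp_def\<close>)
  show "g \<in> Lp" using g int by (simp add: Lp_def)
  show "Lp_norm g \<le> Lp_norm f"
    unfolding Lp_norm_def using f p lep int
    by (intro powr_mono2 integral_mono_AE) (auto simp: Lp_def)
next
  fix f assume f: "f \<in> Lp" "Lp_norm f = 0"
  then have "(\<integral>x. \<bar>f x\<bar> powr p \<partial>M) = 0" by (simp add: Lp_norm_def)
  then have "AE x in M. \<bar>f x\<bar> powr p = 0"
    using f by (subst (asm) integral_nonneg_eq_0_iff_AE) (auto simp: Lp_def)
  then show "AE x in M. f x = 0" by eventually_elim simp
qed (use Lp_add in auto)

lemma kothe_bochner_Lp: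
  assumes "complete_measure M"
  shows "kothe_bochner M Lp = (Lp_bochner M p :: ('s \<Rightarrow> 'x::real_normed_vector) set)"
proof -
  have "(\<lambda>x. norm (f x)) \<in> borel_measurable M" if "bochner_measurable M f" for f :: "'s \<Rightarrow> 'x"
    using complete_measure.bochner_measurable_imp_borel[OF assms that] by measurable
  then show ?thesis by (auto simp: kothe_bochner_def Lp_bochner_def Lp_def)
qed

lemma kothe_bochner_norm_Lp:
  "kothe_bochner_norm Lp_norm = (Lp_bochner_norm M p :: ('s \<Rightarrow> 'x::real_normed_vector) \<Rightarrow> real)"
  by (simp add: kothe_bochner_norm_def Lp_norm_def Lp_bochner_norm_def fun_eq_iff)

text \<open>Setting the approximating functions to zero where they exceed
  \<open>2 * norm (f x)\<close> keeps them simple and makes them dominated, so dominated convergence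
  applies to the \<open>p\<close>-th powers.\<close>

lemma simple_dense_Lp:
  assumes "complete_measure M"
  shows "simple_dense M Lp Lp_norm TYPE('x::real_normed_vector)"
  unfolding simple_dense_def kothe_bochner_norm_Lp kothe_bochner_Lp[OF assms]
proof (intro allI impI)
  interpret complete_measure M by fact
  fix f :: "'s \<Rightarrow> 'x" and e :: real assume f: "f \<in> Lp_bochner M p" and "e > 0"
  then have bm: "bochner_measurable M f" and int: "integrable M (\<lambda>x. norm (f x) powr p)"
    by (auto simp: Lp_bochner_def)
  obtain s where s: "\<And>n. Bochner_Integration.simple_bochner_integrable M (s n)"
    and lim: "AE x in M. (\<lambda>n. s n x) \<longlonglongrightarrow> f x"
    using bm unfolding bochner_measurable_def by blast
  \<comment> \<open>The factor \<open>2\<close> leaves room for the cut-off to be eventually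
    inactive where \<open>f x\<close> is nonzero; where \<open>f x\<close> is zero, so is
    \<open>u n x\<close>. It also leads to the dominating factor \<open>3\<close> below.\<close>
  define u where "u n x = (if norm (s n x) \<le> 2 * norm (f x) then s n x else 0)" for n x
  have [measurable]: "f \<in> borel_measurable M" using bochner_measurable_imp_borel[OF bm] .
  have [measurable]: "s n \<in> borel_measurable M" for n using borel_measurable_simple_bochner[OF s] .
  have u: "Bochner_Integration.simple_bochner_integrable M (u n)" for n
  proof
    have sf: "simple_function M (s n)" and fin: "emeasure M {y \<in> space M. s n y \<noteq> 0} \<noteq> \<infinity>"
      using s[of n] by (auto elim: simple_bochner_integrable.cases)
    show "simple_function M (u n)" unfolding u_def[abs_def]
      by (rule simple_function_If[OF sf]) auto
    have "emeasure M {y \<in> space M. u n y \<noteq> 0} \<le> emeasure M {y \<in> space M. s n y \<noteq> 0}"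
      by (intro emeasure_mono) (auto simp: u_def)
    then show "emeasure M {y \<in> space M. u n y \<noteq> 0} \<noteq> \<infinity>" using fin by (auto simp: top_unique)
  qed
  have "(\<lambda>n. \<integral>x. norm (f x - u n x) powr p \<partial>M) \<longlonglongrightarrow> (\<integral>x. 0 \<partial>M)"
  proof (rule integral_dominated_convergence)
    show "integrable M (\<lambda>x. 3 powr p * norm (f x) powr p)" using int by simp
    have "bochner_measurable M (\<lambda>x. f x + (-1) *\<^sub>R u n x)" for n
      by (intro bochner_measurable_add bochner_measurable_scale bm bochner_measurable_simple u)
    then have [measurable]: "(\<lambda>x. f x - u n x) \<in> borel_measurable M" for n
      using bochner_measurable_imp_borel by fastforce
    show "(\<lambda>x. norm (f x - u n x) powr p) \<in> borel_measurable M" for n by measurable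
    show "AE x in M. norm (norm (f x - u n x) powr p) \<le> 3 powr p * norm (f x) powr p" for n
    proof (rule AE_I2)
      fix x
      have "norm (f x - u n x) \<le> norm (f x) + norm (u n x)" by (rule norm_triangle_ineq4)
      also have "\<dots> \<le> 3 * norm (f x)" by (simp add: u_def)
      finally have "norm (f x - u n x) powr p \<le> (3 * norm (f x)) powr p"
        using p by (intro powr_mono2) auto
      then show "norm (norm (f x - u n x) powr p) \<le> 3 powr p * norm (f x) powr p"
        by (simp add: powr_mult)
    qed
    show "AE x in M. (\<lambda>n. norm (f x - u n x) powr p) \<longlonglongrightarrow> 0"
      using lim
    proof eventually_elim
      fix x assume lim: "(\<lambda>n. s n x) \<longlonglongrightarrow> f x"
      have "(\<lambda>n. u n x) \<longlonglongrightarrow> f x"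
      proof (cases "f x = 0")
        case True
        then have "u n x = 0" for n by (simp add: u_def)
        then show ?thesis using True by simp
      next
        case False
        have "\<forall>\<^sub>F n in sequentially. norm (s n x) < 2 * norm (f x)"
          using tendsto_norm[OF lim] False by (intro order_tendstoD(2)) auto
        then have "\<forall>\<^sub>F n in sequentially. s n x = u n x" by eventually_elim (simp add: u_def)
        with lim show ?thesis by (rule Lim_transform_eventually)
      qed
      then have "(\<lambda>n. norm (f x - u n x)) \<longlonglongrightarrow> norm (f x - f x)" by (intro tendsto_intros)
      then have "(\<lambda>n. norm (f x - u n x) powr p) \<longlonglongrightarrow> 0 powr p"
        using p by (intro tendsto_powr') auto
      then show "(\<lambda>n. norm (f x - u n x) powr p) \<longlonglongrightarrow> 0" using p by simp
    qed
  qed simp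
  then have "(\<lambda>n. \<integral>x. norm (f x - u n x) powr p \<partial>M) \<longlonglongrightarrow> 0" by simp
  then have "\<forall>\<^sub>F n in sequentially. (\<integral>x. norm (f x - u n x) powr p \<partial>M) < e powr p"
    using \<open>e > 0\<close> by (intro order_tendstoD(2)) auto
  then obtain n where n: "(\<integral>x. norm (f x - u n x) powr p \<partial>M) < e powr p"
    by (auto simp: eventually_sequentially)
  have "Lp_bochner_norm M p (\<lambda>x. f x - u n x) < (e powr p) powr (1 / p)"
    unfolding Lp_bochner_norm_def using p n by (intro powr_less_mono2) auto
  also have "\<dots> = e" using p \<open>e > 0\<close> by (simp add: powr_powr)
  finally show "\<exists>s. Bochner_Integration.simple_bochner_integrable M s \<and>
      Lp_bochner_norm M p (\<lambda>t. f t - s t) < e" using u by blast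
qed

end

section \<open>Essentially bounded functions\<close>

text \<open>Lower bounds on the norm can thus be read off a single nonnull set.\<close>

lemma le_esssup_if:
  fixes h :: "'s \<Rightarrow> ereal"
  assumes "B \<in> sets M" "B \<notin> null_sets M" "AE t in M. t \<in> B \<longrightarrow> c \<le> h t"
  shows "c \<le> esssup M h"
proof (rule ccontr)
  assume less: "\<not> c \<le> esssup M h"
  have "AE t in M. t \<notin> B"
    using esssup_AE[of h M] assms(3) by eventually_elim (use less in \<open>auto dest: order_trans\<close>)
  then show False using assms(1,2) by (simp add: AE_iff_null_sets)
qed

text \<open>The values of the approximating simple functions form a countable set that comes
  arbitrarily close to almost every \<open>f t\<close>. If the part of \<open>P\<close> near each
  such value were null, \<open>P\<close> would be null.\<close>

lemma bochner_measurable_nearly_constant: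
  fixes f :: "'s \<Rightarrow> 'x::real_normed_vector"
  assumes "complete_measure M" "sigma_finite_measure M" and bm: "bochner_measurable M f"
    and P: "P \<in> sets M" "P \<notin> null_sets M" and "\<delta> > 0"
  shows "\<exists>x B. B \<in> sets M \<and> B \<subseteq> P \<and> B \<notin> null_sets M \<and> emeasure M B < \<infinity> \<and>
           (\<forall>t\<in>B. norm (f t - x) < \<delta>)"
proof (rule ccontr)
  interpret complete_measure M by fact
  interpret sigma_finite_measure M by fact
  assume none: "\<not> ?thesis"
  obtain s where s: "\<And>n. Bochner_Integration.simple_bochner_integrable M (s n)"
    and lim: "AE x in M. (\<lambda>n. s n x) \<longlonglongrightarrow> f x"
    using bm unfolding bochner_measurable_def by blast
  obtain A :: "nat \<Rightarrow> 's set" where A: "range A \<subseteq> sets M" "(\<Union>i. A i) = space M"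
    "\<And>i. emeasure M (A i) \<noteq> \<infinity>" using sigma_finite by blast
  have [measurable]: "f \<in> borel_measurable M" using bochner_measurable_imp_borel[OF bm] .
  \<comment> \<open>Intersecting with \<open>A m\<close> secures finite measure.\<close>
  define Q where "Q m v = P \<inter> A m \<inter> {t \<in> space M. norm (f t - v) < \<delta>}" for m :: nat and v
  have Q_sets: "Q m v \<in> sets M" for m v
  proof -
    have "{t \<in> space M. norm (f t - v) < \<delta>} = f -` ball v \<delta> \<inter> space M"
      by (auto simp: dist_norm norm_minus_commute)
    also have "\<dots> \<in> sets M" by measurable
    finally show ?thesis using P A(1) unfolding Q_def by auto
  qed
  have Q_null: "Q m v \<in> null_sets M" for m v
  proof (rule ccontr)
    assume "Q m v \<notin> null_sets M"
    moreover have "emeasure M (Q m v) \<le> emeasure M (A m)"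
      using A(1) by (intro emeasure_mono) (auto simp: Q_def)
    then have "emeasure M (Q m v) < \<infinity>" using A(3)[of m] by (simp add: less_top le_less_trans)
    ultimately show False using none Q_sets[of m v] by (auto simp: Q_def)
  qed
  have "(\<Union>n. \<Union>m. \<Union>v\<in>s n ` space M. Q m v) \<in> null_sets M"
  proof (intro null_sets_UN null_sets_UN')
    show "countable (s n ` space M)" for n
      using s[of n] by (auto elim!: simple_bochner_integrable.cases simp: simple_function_def countable_finite)
  qed (rule Q_null)
  from AE_not_in[OF this] lim have "AE t in M. t \<notin> P"
  proof eventually_elim
    fix t assume t: "t \<notin> (\<Union>n. \<Union>m. \<Union>v\<in>s n ` space M. Q m v)" and lim: "(\<lambda>n. s n t) \<longlonglongrightarrow> f t"
    show "t \<notin> P"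
    proof
      assume "t \<in> P"
      then have sp: "t \<in> space M" using P sets.sets_into_space by blast
      then obtain m where "t \<in> A m" using A(2) by blast
      have "\<forall>\<^sub>F n in sequentially. dist (s n t) (f t) < \<delta>" using lim \<open>\<delta> > 0\<close> by (rule tendstoD)
      then obtain n where "dist (s n t) (f t) < \<delta>" by (auto simp: eventually_sequentially)
      then have "t \<in> Q m (s n t)"
        using \<open>t \<in> P\<close> \<open>t \<in> A m\<close> sp by (simp add: Q_def dist_norm norm_minus_commute)
      then show False using t sp by blast
    qed
  qed
  then show False using P sets.sets_into_space[OF P(1)] by (simp add: null_sets_iff_AE)
qed

text \<open>Density of simple functions can fail here, hence a direct argument: \<open>f\<close> is
  nearly the constant \<open>x\<close> on \<open>B\<close>, and the norm of
  \<open>s *\<^sub>R f t + g t\<close> is estimated from below on \<open>B\<close> alone. Finite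
  measure of \<open>B\<close> makes \<open>g\<close> simple.\<close>

lemma LOH_Linf_bochner:
  assumes LOH: "LOH TYPE('x::real_normed_vector)"
    and M: "complete_measure M" "sigma_finite_measure M" "emeasure M (space M) > 0"
  shows "LOH_fun (Linf_bochner M :: ('s \<Rightarrow> 'x) set) (Linf_bochner_norm M)"
  unfolding LOH_fun_def
proof (intro ballI allI impI)
  interpret complete_measure M by fact
  fix f :: "'s \<Rightarrow> 'x" and \<epsilon> :: real assume f: "f \<in> Linf_bochner M" and "\<epsilon> > 0"
  have meas: "(\<lambda>x. ereal (norm (h x))) \<in> borel_measurable M" if "bochner_measurable M h" for h :: "'s \<Rightarrow> 'x"
    using bochner_measurable_imp_borel[OF that] by measurable
  have bm: "bochner_measurable M f" and fin: "esssup M (\<lambda>x. ereal (norm (f x))) < \<infinity>"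
    using f by (auto simp: Linf_bochner_def)
  have space: "space M \<notin> null_sets M" using M(3) by auto
  have "0 \<le> esssup M (\<lambda>x. ereal (norm (f x)))" by (rule le_esssup_if[OF _ space]) auto
  then obtain R where R: "esssup M (\<lambda>x. ereal (norm (f x))) = ereal R" and "0 \<le> R"
    using fin by (cases "esssup M (\<lambda>x. ereal (norm (f x)))") auto
  have Nf: "Linf_bochner_norm M f = R" by (simp add: Linf_bochner_norm_def R)
  define \<delta> where "\<delta> = min \<epsilon> 1 / 2"
  have \<delta>: "0 < \<delta>" "\<delta> < 1" "2 * \<delta> \<le> \<epsilon>" using \<open>\<epsilon> > 0\<close> by (auto simp: \<delta>_def)
  \<comment> \<open>Twice \<open>\<eta>\<close> is lost in \<open>norm x\<close> against
    \<open>R\<close> and once in \<open>f t\<close> against \<open>x\<close>, which makes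
    \<open>\<delta> * R\<close> in total. If \<open>R = 0\<close>, any positive value will
    do.\<close>
  define \<eta> where "\<eta> = (if R = 0 then 1 else \<delta> * R / 3)"
  have "\<eta> > 0" using \<open>0 \<le> R\<close> \<delta> by (simp add: \<eta>_def)
  define P where "P = {x \<in> space M. ereal (R - \<eta>) < ereal (norm (f x))}"
  have P: "P \<in> sets M" unfolding P_def using meas[OF bm] by measurable
  have "emeasure M P > 0"
    unfolding P_def using meas[OF bm] \<open>\<eta> > 0\<close> by (intro esssup_pos_measure) (auto simp: R)
  then have "P \<notin> null_sets M" by auto
  then obtain x B where B: "B \<in> sets M" "B \<subseteq> P" "B \<notin> null_sets M" "emeasure M B < \<infinity>"
    and near: "\<And>t. t \<in> B \<Longrightarrow> norm (f t - x) < \<eta>"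
    using bochner_measurable_nearly_constant[OF M(1,2) bm P _ \<open>\<eta> > 0\<close>] by blast
  obtain y :: 'x where y: "norm y = 1" "\<And>s. (1 - \<delta>) * (\<bar>s\<bar> * norm x + 1) \<le> norm (s *\<^sub>R x + y)"
    using LOH \<delta>(1) unfolding LOH_def by blast
  have "B \<noteq> {}" using B(3) by auto
  then obtain t0 where "t0 \<in> B" by blast
  then have "R - \<eta> < norm (f t0)" "norm (f t0 - x) < \<eta>" using B(2) near by (auto simp: P_def)
  then have x: "R - 2 * \<eta> \<le> norm x" using norm_triangle_ineq2[of "f t0" x] by linarith
  define g where "g = (\<lambda>t. indicator B t *\<^sub>R y)"
  have bg: "bochner_measurable M g" unfolding g_def
    by (intro bochner_measurable_simple simple_bochner_integrable_indicator_scale B)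
  have ng: "norm (g t) = indicator B t" for t using y(1) by (simp add: g_def)
  have "esssup M (\<lambda>t. ereal (norm (g t))) = 1"
  proof (rule antisym)
    show "esssup M (\<lambda>t. ereal (norm (g t))) \<le> 1"
      by (rule esssup_I[OF meas[OF bg]]) (auto simp: ng indicator_def)
    show "1 \<le> esssup M (\<lambda>t. ereal (norm (g t)))"
      by (rule le_esssup_if[OF B(1,3)]) (auto simp: ng)
  qed
  then have g: "g \<in> Linf_bochner M" "Linf_bochner_norm M g = 1"
    using bg by (auto simp: Linf_bochner_def Linf_bochner_norm_def)
  have "(1 - \<epsilon>) * (\<bar>s\<bar> * R + 1) \<le> Linf_bochner_norm M (\<lambda>t. s *\<^sub>R f t + g t)" for s
  proof -
    define h where "h t = s *\<^sub>R f t + g t" for t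
    have bh: "bochner_measurable M h" unfolding h_def[abs_def]
      by (intro bochner_measurable_add bochner_measurable_scale bm bg)
    define S where "S = esssup M (\<lambda>t. ereal (norm (h t)))"
    have f_le: "AE t in M. ereal (norm (f t)) \<le> ereal R" using esssup_AE[of "\<lambda>x. ereal (norm (f x))" M] by (simp add: R)
    \<comment> \<open>Together with \<open>low\<close>, this makes \<open>S\<close> finite, so
      passing to real numbers preserves the inequalities.\<close>
    then have "AE t in M. ereal (norm (h t)) \<le> ereal (\<bar>s\<bar> * R + 1)"
    proof eventually_elim
      fix t assume "ereal (norm (f t)) \<le> ereal R"
      then have "\<bar>s\<bar> * norm (f t) \<le> \<bar>s\<bar> * R" by (intro mult_left_mono) auto
      moreover have "norm (h t) \<le> \<bar>s\<bar> * norm (f t) + norm (g t)"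
        unfolding h_def using norm_triangle_ineq[of "s *\<^sub>R f t" "g t"] by simp
      moreover have "norm (g t) \<le> 1" by (simp add: ng indicator_def)
      ultimately show "ereal (norm (h t)) \<le> ereal (\<bar>s\<bar> * R + 1)" by simp
    qed
    then have "S \<le> ereal (\<bar>s\<bar> * R + 1)" unfolding S_def by (rule esssup_I[OF meas[OF bh]])
    moreover have low: "ereal ((1 - \<delta>) * (\<bar>s\<bar> * norm x + 1) - \<bar>s\<bar> * \<eta>) \<le> S"
      unfolding S_def
    proof (rule le_esssup_if[OF B(1,3)], intro AE_I2 impI)
      fix t assume "t \<in> B"
      have "norm (s *\<^sub>R x + y) \<le> norm (h t) + norm (s *\<^sub>R (f t - x))"
        using norm_triangle_ineq4[of "h t" "s *\<^sub>R (f t - x)"] \<open>t \<in> B\<close>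
        by (simp add: h_def g_def algebra_simps)
      moreover have "norm (s *\<^sub>R (f t - x)) \<le> \<bar>s\<bar> * \<eta>"
        using near[OF \<open>t \<in> B\<close>] by (simp add: mult_left_mono)
      ultimately show "ereal ((1 - \<delta>) * (\<bar>s\<bar> * norm x + 1) - \<bar>s\<bar> * \<eta>) \<le> ereal (norm (h t))"
        using y(2)[of s] by simp
    qed
    ultimately obtain r where r: "S = ereal r" by (cases S) auto
    have "(1 - \<epsilon>) * (\<bar>s\<bar> * R + 1) \<le> (1 - 2 * \<delta>) * (\<bar>s\<bar> * R + 1)"
      using \<delta>(3) \<open>0 \<le> R\<close> by (intro mult_right_mono) auto
    also have "\<dots> \<le> r"
    proof (cases "R = 0")
      case True
      \<comment> \<open>As \<open>f\<close> vanishes a.e., \<open>h\<close> equals \<open>y\<close>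
        at almost all points of \<open>B\<close>.\<close>
      have "1 \<le> S" unfolding S_def
      proof (rule le_esssup_if[OF B(1,3)])
        show "AE t in M. t \<in> B \<longrightarrow> 1 \<le> ereal (norm (h t))"
          using f_le by eventually_elim (use True y(1) in \<open>auto simp: h_def g_def\<close>)
      qed
      then show ?thesis using True \<delta>(1) r by simp
    next
      case False
      have "(1 - \<delta>) * (\<bar>s\<bar> * (R - 2 * \<eta>) + 1) \<le> (1 - \<delta>) * (\<bar>s\<bar> * norm x + 1)"
        using x \<delta>(2) by (intro mult_left_mono add_right_mono) auto
      then have "(1 - \<delta>) * (\<bar>s\<bar> * (R - 2 * \<eta>) + 1) - \<bar>s\<bar> * \<eta> \<le> r" using low r by simp
      moreover have "0 \<le> \<delta> * (\<bar>s\<bar> * \<eta>)" using \<delta>(1) \<open>\<eta> > 0\<close> by simp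
      moreover have "3 * (\<bar>s\<bar> * \<eta>) = \<delta> * (\<bar>s\<bar> * R)" using False by (simp add: \<eta>_def)
      moreover have "(1 - \<delta>) * (\<bar>s\<bar> * (R - 2 * \<eta>) + 1) - \<bar>s\<bar> * \<eta> =
          (1 - 2 * \<delta>) * (\<bar>s\<bar> * R + 1) + \<delta> * (\<bar>s\<bar> * R) + \<delta> - 3 * (\<bar>s\<bar> * \<eta>) + 2 * (\<delta> * (\<bar>s\<bar> * \<eta>))"
        by (simp add: algebra_simps)
      ultimately show ?thesis using \<delta>(1) by linarith
    qed
    finally show ?thesis using r by (simp add: Linf_bochner_norm_def S_def h_def)
  qed
  then show "\<exists>g\<in>Linf_bochner M. Linf_bochner_norm M g = 1 \<and> (\<forall>s. (1 - \<epsilon>) *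
      (\<bar>s\<bar> * Linf_bochner_norm M f + 1) \<le> Linf_bochner_norm M (\<lambda>t. s *\<^sub>R f t + g t))"
    using g by (auto simp: Nf)
qed

text \<open>Positive total measure excludes the zero space, which has no unit vector. Koethe spaces
  and \<open>Lp M p\<close> are both instances of \<open>koethe_lattice\<close>, which yields the
  first two claims.\<close>

theorem theorem4p1:
  fixes M :: "'s measure"
  assumes "complete_measure M"
    and "sigma_finite_measure M"
    and "emeasure M (space M) > 0"
  shows
    "(\<forall>(E :: ('s \<Rightarrow> real) set) NE.
        koethe_space M E NE \<and> simple_dense M E NE TYPE('x::banach) \<longrightarrow>
        (LOH TYPE('x) \<longrightarrow> LOH_fun (kothe_bochner M E :: ('s \<Rightarrow> 'x) set) (kothe_bochner_norm NE)) \<and>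
        (WOH TYPE('x) \<longrightarrow> WOH_fun (kothe_bochner M E :: ('s \<Rightarrow> 'x) set) (kothe_bochner_norm NE)))
     \<and> (\<forall>p::real. 1 \<le> p \<longrightarrow>
        (LOH TYPE('x) \<longrightarrow> LOH_fun (Lp_bochner M p :: ('s \<Rightarrow> 'x) set) (Lp_bochner_norm M p)) \<and>
        (WOH TYPE('x) \<longrightarrow> WOH_fun (Lp_bochner M p :: ('s \<Rightarrow> 'x) set) (Lp_bochner_norm M p)))
     \<and> (LOH TYPE('x) \<longrightarrow> LOH_fun (Linf_bochner M :: ('s \<Rightarrow> 'x) set) (Linf_bochner_norm M))"
proof (intro conjI allI impI)
  fix E :: "('s \<Rightarrow> real) set" and NE
  assume E: "koethe_space M E NE \<and> simple_dense M E NE TYPE('x)"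
  then interpret koethe_lattice M E NE using koethe_space_imp_lattice assms(1) by blast
  show "LOH_fun (KB :: ('s \<Rightarrow> 'x) set) KN" if "LOH TYPE('x)"
    using LOH_kothe_bochner that E assms(2,3) by blast
  show "WOH_fun (KB :: ('s \<Rightarrow> 'x) set) KN" if "WOH TYPE('x)"
    using WOH_kothe_bochner that E assms(2,3) by blast
next
  fix p :: real assume p: "1 \<le> p"
  interpret koethe_lattice M "Lp M p" "Lp_norm M p" using p assms(1) by (rule koethe_lattice_Lp)
  note dense = simple_dense_Lp[OF p assms(1), where 'x = 'x]
  note eqs = kothe_bochner_Lp[OF p assms(1), where 'x = 'x]
    kothe_bochner_norm_Lp[OF p, of M, where 'x = 'x]
  show "LOH_fun (Lp_bochner M p :: ('s \<Rightarrow> 'x) set) (Lp_bochner_norm M p)" if "LOH TYPE('x)"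
    using LOH_kothe_bochner[OF that dense assms(2,3)] unfolding eqs .
  show "WOH_fun (Lp_bochner M p :: ('s \<Rightarrow> 'x) set) (Lp_bochner_norm M p)" if "WOH TYPE('x)"
    using WOH_kothe_bochner[OF that dense assms(2,3)] unfolding eqs .
next
  show "LOH_fun (Linf_bochner M :: ('s \<Rightarrow> 'x) set) (Linf_bochner_norm M)" if "LOH TYPE('x)"
    using LOH_Linf_bochner that assms by blast
qed

end
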